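(* Let $(k_n)_{n\ge0}$ be a sequence of random positive integers. Let $((\boldsymbol Y_{n,k})_{k=1}^{k_n})_{n\ge0}$ be a triangular array of random variables in $\mathbb C^d$ that are row-wise independent (for each $n$, the $\boldsymbol Y_{n,k}$ are independent over $k$) and independent of the $k_n$ (so $k_n$ only determines the number of variables in row $n$, not their values). Assume that, as $n\to\infty$: 1. $k_n\xrightarrow{p}\infty$. 2. There exist deterministic matrices $\Sigma_1,\Sigma_2\in\mathbb C^{d\times d}$ such that $$\sum_{k=1}^{k_n}\mathrm{Cov}(\boldsymbol Y_{n,k},\boldsymbol Y_{n,k})\xrightarrow{p}\Sigma_1,\qquad\sum_{k=1}^{k_n}\mathrm{Cov}(\boldsymbol Y_{n,k},\overline{\boldsymbol Y}_{n,k})\xrightarrow{p}\Sigma_2.$$ 3. There exists $p>2$ such that $\sum_{k=1}^{k_n}\mathbb E\big[\|\boldsymbol Y_{n,k}-\mathbb E[\boldsymbol Y_{n,k}]\|_2^p\big]\xrightarrow{p}0$. Let $\boldsymbol W$ be a (mean-zero) Gaussian random variable in $\mathbb C^d$ with $\mathrm{Var}(\boldsymbol W)=\Sigma_1$ and $\mathrm{Cov}(\boldsymbol W,\overline{\boldsymbol W})=\Sigma_2$. Then, for any $\boldsymbol W$-continuity set $B\subseteq\mathbb C^d$, the row sums $\boldsymbol S_n=\sum_{k=1}^{k_n}(\boldsymbol Y_{n,k}-\mathbb E[\boldsymbol Y_{n,k}])$ satisfy $$\mathbb P(\boldsymbol S_n\in B\mid k_n)\xrightarrow{p}\mathbb P(\boldsymbol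 W\in B)\qquad\text{as }n\to\infty.$$
   Context: $\mathrm{Cov}(\boldsymbol X,\boldsymbol Y)=\mathbb E[(\boldsymbol X-\mathbb E\boldsymbol X)(\boldsymbol Y-\mathbb E\boldsymbol Y)']$ (transpose, no conjugation), $\mathrm{Var}(\boldsymbol X)=\mathrm{Cov}(\boldsymbol X,\boldsymbol X)$. In conditions 2 and 3, the covariances and expectations of the individual $\boldsymbol Y_{n,k}$ are deterministic quantities (assumed to exist) and the sums are random only through the upper limit $k_n$. One may regard each row as $(\boldsymbol Y_{n,k})_{k\ge1}$, independent of $k_n$, of which the first $k_n$ are used. $B$ is a $\boldsymbol W$-continuity set if it is Borel and $\mathbb P(\boldsymbol W\in\partial B)=0$, where $\partial B$ is the boundary. $k_n\xrightarrow{p}\infty$ means $\mathbb P(k_n>M)\to1$ for every $M$. $\|\cdot\|_2$ is the Euclidean norm on $\mathbb C^d$. *)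

theory Defs
  imports "HOL-Probability.Probability"
begin

definition tendsto_in_prob ::
    "'a measure \<Rightarrow> (nat \<Rightarrow> 'a \<Rightarrow> 'b :: metric_space) \<Rightarrow> 'b \<Rightarrow> bool" where
  "tendsto_in_prob M X c \<longleftrightarrow>
     (\<forall>\<epsilon>>0. (\<lambda>n. measure M {\<omega> \<in> space M. dist (X n \<omega>) c > \<epsilon>}) \<longlonglongrightarrow> 0)"

definition cnj_vec :: "complex ^ 'd \<Rightarrow> complex ^ 'd" where
  "cnj_vec x = (\<chi> i. cnj (x $ i))"

text \<open>The transpose in the covariance is taken without conjugation, so that the usual
  Hermitian covariance matrix of \<open>X\<close> is \<open>Cov M X (\<lambda>\<omega>. cnj_vec (X \<omega>))\<close>. The product of a
  column vector and a row vector below is the outer product.\<close>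

definition Cov ::
    "'a measure \<Rightarrow> ('a \<Rightarrow> complex ^ 'd) \<Rightarrow> ('a \<Rightarrow> complex ^ 'd) \<Rightarrow> complex ^ 'd ^ 'd" where
  "Cov M X Y =
     (LINT \<omega>|M. (columnvector (X \<omega> - integral\<^sup>L M X) :: complex ^ 1 ^ 'd)
               ** (rowvector (Y \<omega> - integral\<^sup>L M Y) :: complex ^ 'd ^ 1))"

definition Var :: "'a measure \<Rightarrow> ('a \<Rightarrow> complex ^ 'd) \<Rightarrow> complex ^ 'd ^ 'd" where
  "Var M X = Cov M X X"

text \<open>A random vector is Gaussian if all its real linear functionals are univariate Gaussian,
  possibly degenerate. On \<open>complex ^ 'd\<close> the inner product is the real one,
  \<open>u \<bullet> x = Re (\<Sum>i\<in>UNIV. cnj (u $ i) * x $ i)\<close>, so this is joint Gaussianity of the real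
  and imaginary parts of all components.\<close>

definition gaussian_vector :: "'a measure \<Rightarrow> ('a \<Rightarrow> 'b :: euclidean_space) \<Rightarrow> bool" where
  "gaussian_vector M X \<longleftrightarrow>
     X \<in> borel_measurable M \<and>
     (\<forall>u. (\<exists>\<mu>. AE \<omega> in M. u \<bullet> X \<omega> = \<mu>) \<or>
          (\<exists>\<mu> \<sigma>. \<sigma> > 0 \<and> distributed M lborel (\<lambda>\<omega>. u \<bullet> X \<omega>) (normal_density \<mu> \<sigma>)))"

definition continuity_set ::
    "'a measure \<Rightarrow> ('a \<Rightarrow> 'b :: topological_space) \<Rightarrow> 'b set \<Rightarrow> bool" where
  "continuity_set M X B \<longleftrightarrow>
     B \<in> sets borel \<and> measure M {\<omega> \<in> space M. X \<omega> \<in> frontier B} = 0"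

definition sigma_gen :: "'a measure \<Rightarrow> 'b measure \<Rightarrow> ('a \<Rightarrow> 'b) \<Rightarrow> 'a measure" where
  "sigma_gen M N X = vimage_algebra (space M) X N"

definition cond_prob_given ::
    "'a measure \<Rightarrow> ('a \<Rightarrow> bool) \<Rightarrow> ('a \<Rightarrow> nat) \<Rightarrow> 'a \<Rightarrow> real" where
  "cond_prob_given M P K =
     real_cond_exp M (sigma_gen M (count_space UNIV) K) (indicator {\<omega> \<in> space M. P \<omega>})"

end

theory Submission
  imports Defs
begin

text \<open>Given \<open>K n = m\<close>, the conditional probability is the unconditional probability \<open>q n m\<close> that the sum
  of the first \<open>m\<close> centred entries of row \<open>n\<close> lies in \<open>B\<close>. So it suffices that \<open>q n m\<close> is
  within \<open>\<epsilon>\<close> of the Gaussian probability as soon as the two covariance sums and the Lyapunov sum are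
  within \<open>\<delta>\<close> of their limits, uniformly in \<open>n\<close> and \<open>m\<close>; by contradiction this is a deterministic
  Lyapunov central limit theorem for triangular arrays.

  That theorem reduces, along each real linear functional, to a one-dimensional estimate of
  characteristic functions, because the two complex covariance matrices together determine the
  variances of all real functionals. Pointwise convergence of characteristic functions gives weak
  convergence without Levy's continuity theorem: second moments are bounded, and a bounded
  continuous function agrees on a box with a continuous function of the variables
  \<open>sin (a * x\<^sub>i)\<close>, which Stone--Weierstrass approximates by trigonometric polynomials.\<close>

subsection \<open>A one-dimensional Lyapunov estimate\<close>

lemma square_le_powr_truncation:
  fixes z \<eta> p :: real
  assumes "p > 2" "\<eta> > 0" "\<bar>z\<bar> \<ge> \<eta>"
  shows "z\<^sup>2 \<le> \<eta> powr (2 - p) * \<bar>z\<bar> powr p"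
proof -
  have "z\<^sup>2 = \<bar>z\<bar> powr (2 - p) * \<bar>z\<bar> powr p"
    using assms by (simp flip: powr_add)
  also have "\<dots> \<le> \<eta> powr (2 - p) * \<bar>z\<bar> powr p"
    using assms by (intro mult_right_mono powr_mono2') auto
  finally show ?thesis .
qed

text \<open>The left side is the Taylor remainder of a characteristic function at \<open>1\<close>.
  Below the level \<open>\<eta>\<close> the cube loses a factor \<open>\<eta>\<close> to the square;
  above it the square is dominated by the \<open>p\<close>-th power, because \<open>2 - p\<close> is
  negative. No third moment is needed, so \<open>p\<close> may lie anywhere above
  \<open>2\<close>.\<close>

lemma min_square_cube_le:
  fixes z \<eta> p :: real
  assumes "p > 2" "\<eta> > 0"
  shows "min (6 * z\<^sup>2) (\<bar>z\<bar> ^ 3) \<le> 6 * (\<eta> * z\<^sup>2 + \<eta> powr (2 - p) * \<bar>z\<bar> powr p)"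
proof (cases "\<bar>z\<bar> \<ge> \<eta>")
  case True
  have "min (6 * z\<^sup>2) (\<bar>z\<bar> ^ 3) \<le> 6 * z\<^sup>2" by simp
  moreover have "0 \<le> \<eta> * z\<^sup>2" using assms by simp
  ultimately show ?thesis
    using square_le_powr_truncation[OF assms True] unfolding distrib_left by linarith
next
  case False
  have "\<bar>z\<bar> ^ 3 = \<bar>z\<bar> * z\<^sup>2" by (simp add: power3_eq_cube power2_eq_square)
  also have "\<dots> \<le> \<eta> * z\<^sup>2" using False by (intro mult_right_mono) auto
  finally have "\<bar>z\<bar> ^ 3 \<le> \<eta> * z\<^sup>2" .
  moreover have "0 \<le> \<eta> * z\<^sup>2" "0 \<le> \<eta> powr (2 - p) * \<bar>z\<bar> powr p" using assms by simp_all
  ultimately show ?thesis unfolding distrib_left by linarith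
qed

text \<open>Integrated, this makes each single variance small as soon as its \<open>p\<close>-th
  moment is, which is how the Lyapunov condition rules out a dominating summand.\<close>

lemma square_le_truncation:
  fixes z \<eta> p :: real
  assumes "p > 2" "\<eta> > 0"
  shows "z\<^sup>2 \<le> \<eta>\<^sup>2 + \<eta> powr (2 - p) * \<bar>z\<bar> powr p"
proof (cases "\<bar>z\<bar> \<ge> \<eta>")
  case True
  then show ?thesis
    using square_le_powr_truncation[OF assms True] by (simp add: add_increasing)
next
  case False
  then have "z\<^sup>2 \<le> \<eta>\<^sup>2" using assms by (simp add: abs_le_square_iff[symmetric])
  then show ?thesis by (simp add: add_increasing2)
qed

text \<open>Both directions come from \<open>1 + y \<le> exp y\<close>: with \<open>y = - x\<close>
  for the lower bound on \<open>exp (- x)\<close>, and with \<open>y = x\<close> after taking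
  reciprocals for the upper one.\<close>

lemma exp_minus_approx:
  fixes x :: real
  assumes "x \<ge> 0"
  shows "\<bar>1 - x - exp (- x)\<bar> \<le> x\<^sup>2"
proof -
  have "exp (- x) \<le> 1 / (1 + x)"
    using exp_ge_add_one_self[of x] assms by (simp add: exp_minus field_simps)
  also have "\<dots> \<le> 1 - x + x\<^sup>2"
    using assms by (simp add: field_simps power2_eq_square)
  finally show ?thesis using exp_ge_add_one_self[of "- x"] by linarith
qed

text \<open>Independence factors the characteristic function, and \<open>exp (- v / 2)\<close>
  factors along the variances. All factors have modulus at most \<open>1\<close>, so the difference
  of the products is at most the sum of the differences of the factors. Each of these passes through
  \<open>1 - w i / 2\<close>. The truncation level \<open>\<eta>\<close> stays free, to be chosen in
  the limit.\<close>

lemma (in prob_space) char_sum_gaussian_bound: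
  fixes X :: "'i \<Rightarrow> 'a \<Rightarrow> real" and p \<eta> :: real
  assumes "finite I" and indep: "indep_vars (\<lambda>_. borel) X I"
    and sq: "\<And>i. i \<in> I \<Longrightarrow> integrable M (\<lambda>\<omega>. (X i \<omega>)\<^sup>2)"
    and mean: "\<And>i. i \<in> I \<Longrightarrow> expectation (X i) = 0"
    and mom: "\<And>i. i \<in> I \<Longrightarrow> integrable M (\<lambda>\<omega>. \<bar>X i \<omega>\<bar> powr p)"
    and p: "p > 2" and \<eta>: "\<eta> > 0"
  defines "v \<equiv> \<Sum>i\<in>I. expectation (\<lambda>\<omega>. (X i \<omega>)\<^sup>2)"
    and "\<Lambda> \<equiv> \<Sum>i\<in>I. expectation (\<lambda>\<omega>. \<bar>X i \<omega>\<bar> powr p)"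
  shows "cmod (expectation (\<lambda>\<omega>. iexp (\<Sum>i\<in>I. X i \<omega>)) - exp (- v / 2))
    \<le> \<eta> * v + \<eta> powr (2 - p) * \<Lambda> + (\<eta>\<^sup>2 + \<eta> powr (2 - p) * \<Lambda>) * v"
proof -
  define w where "w i = expectation (\<lambda>\<omega>. (X i \<omega>)\<^sup>2)" for i
  define l where "l i = expectation (\<lambda>\<omega>. \<bar>X i \<omega>\<bar> powr p)" for i
  define \<phi> where "\<phi> i = char (distr M borel (X i)) 1" for i
  have rv[measurable]: "random_variable borel (X i)" if "i \<in> I" for i
    using indep that unfolding indep_vars_def2 by simp
  have int1: "integrable M (X i)" if "i \<in> I" for i
    by (rule square_integrable_imp_integrable[OF rv[OF that] sq[OF that]])
  have w0: "w i \<ge> 0" and l0: "l i \<ge> 0" for i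
    unfolding w_def l_def by (auto intro!: integral_nonneg_AE)
  have "expectation (\<lambda>\<omega>. iexp (\<Sum>i\<in>I. X i \<omega>)) = char (distr M borel (\<lambda>\<omega>. \<Sum>i\<in>I. X i \<omega>)) 1"
    unfolding char_def by (subst integral_distr) auto
  also have "\<dots> = (\<Prod>i\<in>I. \<phi> i)"
    unfolding \<phi>_def by (rule char_distr_sum[OF indep])
  finally have 1: "expectation (\<lambda>\<omega>. iexp (\<Sum>i\<in>I. X i \<omega>)) = (\<Prod>i\<in>I. \<phi> i)" .
  have 2: "complex_of_real (exp (- v / 2)) = (\<Prod>i\<in>I. complex_of_real (exp (- w i / 2)))"
    using \<open>finite I\<close>
    by (simp add: v_def w_def[symmetric] exp_sum[symmetric] sum_negf sum_divide_distrib
        flip: of_real_prod)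
  have term1: "cmod (\<phi> i - (1 - w i / 2)) \<le> \<eta> * w i + \<eta> powr (2 - p) * l i" if i: "i \<in> I" for i
  proof -
    have "cmod (\<phi> i - (1 - 1\<^sup>2 * w i / 2))
        \<le> 1\<^sup>2 / 6 * expectation (\<lambda>x. min (6 * (X i x)\<^sup>2) (\<bar>1\<bar> * \<bar>X i x\<bar> ^ 3))"
      unfolding \<phi>_def
      using char_approx3'[OF rv[OF i] int1[OF i] sq[OF i] mean[OF i] _ refl, of "w i" 1] mean[OF i]
      by (simp add: w_def)
    also have "\<dots> \<le> 1 / 6 * expectation (\<lambda>x. 6 * (\<eta> * (X i x)\<^sup>2 + \<eta> powr (2 - p) * \<bar>X i x\<bar> powr p))"
    proof -
      have "expectation (\<lambda>x. min (6 * (X i x)\<^sup>2) (\<bar>X i x\<bar> ^ 3))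
          \<le> expectation (\<lambda>x. 6 * (\<eta> * (X i x)\<^sup>2 + \<eta> powr (2 - p) * \<bar>X i x\<bar> powr p))"
      proof (rule integral_mono)
        show "integrable M (\<lambda>x. min (6 * (X i x)\<^sup>2) (\<bar>X i x\<bar> ^ 3))"
          by (rule Bochner_Integration.integrable_bound[where f = "\<lambda>x. 6 * (X i x)\<^sup>2"])
            (use sq[OF i] i in auto)
      qed (use sq mom i min_square_cube_le[OF p \<eta>] in auto)
      then show ?thesis by simp
    qed
    also have "\<dots> = \<eta> * w i + \<eta> powr (2 - p) * l i"
      using sq[OF i] mom[OF i] by (simp add: w_def l_def)
    finally show ?thesis by simp
  qed
  \<comment> \<open>A uniform bound on the single variances: truncate at \<open>\<eta>\<close> and
    replace the \<open>p\<close>-th moment of \<open>X i\<close> by the whole Lyapunov sum.\<close>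
  have wle: "w i \<le> \<eta>\<^sup>2 + \<eta> powr (2 - p) * \<Lambda>" if i: "i \<in> I" for i
  proof -
    have "w i \<le> expectation (\<lambda>x. \<eta>\<^sup>2 + \<eta> powr (2 - p) * \<bar>X i x\<bar> powr p)"
      unfolding w_def
      by (rule integral_mono) (use sq mom i square_le_truncation[OF p \<eta>] in auto)
    also have "\<dots> = \<eta>\<^sup>2 + \<eta> powr (2 - p) * l i"
      using mom[OF i] by (simp add: l_def prob_space)
    also have "\<dots> \<le> \<eta>\<^sup>2 + \<eta> powr (2 - p) * \<Lambda>"
      unfolding \<Lambda>_def l_def[symmetric]
      using member_le_sum[OF i, of l] \<open>finite I\<close> l0 by (simp add: mult_left_mono)
    finally show ?thesis .
  qed
  \<comment> \<open>The error is quadratic in \<open>w i\<close>. One factor is absorbed by the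
    uniform bound \<open>wle\<close>, so that the other still sums to \<open>v\<close>.\<close>
  have term2: "cmod ((1 - w i / 2) - exp (- w i / 2)) \<le> (\<eta>\<^sup>2 + \<eta> powr (2 - p) * \<Lambda>) * w i"
    if i: "i \<in> I" for i
  proof -
    have "cmod ((1 - w i / 2) - exp (- w i / 2)) = \<bar>1 - w i / 2 - exp (- (w i / 2))\<bar>"
      by (simp flip: norm_of_real[where 'a = complex])
    also have "\<dots> \<le> (w i / 2)\<^sup>2"
      using exp_minus_approx[of "w i / 2"] w0[of i] by simp
    also have "\<dots> \<le> w i * w i"
      using w0[of i] by (simp add: power2_eq_square)
    also have "\<dots> \<le> (\<eta>\<^sup>2 + \<eta> powr (2 - p) * \<Lambda>) * w i"
      using wle[OF i] w0[of i] by (intro mult_right_mono)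
    finally show ?thesis .
  qed
  have "cmod ((\<Prod>i\<in>I. \<phi> i) - (\<Prod>i\<in>I. complex_of_real (exp (- w i / 2))))
      \<le> (\<Sum>i\<in>I. cmod (\<phi> i - complex_of_real (exp (- w i / 2))))"
  proof (rule norm_prod_diff)
    fix i assume "i \<in> I"
    then show "cmod (\<phi> i) \<le> 1"
      unfolding \<phi>_def by (intro real_distribution.cmod_char_le_1 real_distribution_distr rv)
    show "cmod (complex_of_real (exp (- w i / 2))) \<le> 1" using w0[of i] by simp
  qed
  also have "\<dots> \<le> (\<Sum>i\<in>I. \<eta> * w i + \<eta> powr (2 - p) * l i + (\<eta>\<^sup>2 + \<eta> powr (2 - p) * \<Lambda>) * w i)"
  proof (rule sum_mono)
    fix i assume i: "i \<in> I"
    have "cmod (\<phi> i - complex_of_real (exp (- w i / 2)))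
        \<le> cmod (\<phi> i - (1 - w i / 2)) + cmod ((1 - w i / 2) - exp (- w i / 2))"
      by (rule order_trans[OF _ norm_triangle_ineq]) simp
    then show "cmod (\<phi> i - complex_of_real (exp (- w i / 2)))
        \<le> \<eta> * w i + \<eta> powr (2 - p) * l i + (\<eta>\<^sup>2 + \<eta> powr (2 - p) * \<Lambda>) * w i"
      using term1[OF i] term2[OF i] by linarith
  qed
  also have "\<dots> = \<eta> * v + \<eta> powr (2 - p) * \<Lambda> + (\<eta>\<^sup>2 + \<eta> powr (2 - p) * \<Lambda>) * v"
    by (simp add: sum.distrib v_def \<Lambda>_def w_def l_def sum_distrib_left)
  finally show ?thesis unfolding 1 2 .
qed

text \<open>Two limits in a fixed order: for fixed \<open>\<eta>\<close> the bound converges as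
  \<open>j\<close> grows and all terms with \<open>\<eta> powr (2 - p)\<close> vanish, however large
  that factor is; only then is \<open>\<eta>\<close> small enough to matter.\<close>

theorem (in prob_space) lyapunov_char_limit:
  fixes X :: "nat \<Rightarrow> 'i \<Rightarrow> 'a \<Rightarrow> real" and I :: "nat \<Rightarrow> 'i set" and p v :: real
  assumes fin: "\<And>j. finite (I j)" and indep: "\<And>j. indep_vars (\<lambda>_. borel) (X j) (I j)"
    and sq: "\<And>i j. i \<in> I j \<Longrightarrow> integrable M (\<lambda>\<omega>. (X j i \<omega>)\<^sup>2)"
    and mean: "\<And>i j. i \<in> I j \<Longrightarrow> expectation (X j i) = 0"
    and mom: "\<And>i j. i \<in> I j \<Longrightarrow> integrable M (\<lambda>\<omega>. \<bar>X j i \<omega>\<bar> powr p)"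
    and p: "p > 2"
    and var: "(\<lambda>j. \<Sum>i\<in>I j. expectation (\<lambda>\<omega>. (X j i \<omega>)\<^sup>2)) \<longlonglongrightarrow> v"
    and lyap: "(\<lambda>j. \<Sum>i\<in>I j. expectation (\<lambda>\<omega>. \<bar>X j i \<omega>\<bar> powr p)) \<longlonglongrightarrow> 0"
  shows "(\<lambda>j. expectation (\<lambda>\<omega>. iexp (\<Sum>i\<in>I j. X j i \<omega>))) \<longlonglongrightarrow> exp (- v / 2)"
proof -
  define s where "s j = (\<Sum>i\<in>I j. expectation (\<lambda>\<omega>. (X j i \<omega>)\<^sup>2))" for j
  define l where "l j = (\<Sum>i\<in>I j. expectation (\<lambda>\<omega>. \<bar>X j i \<omega>\<bar> powr p))" for j
  define E where "E j = cmod (expectation (\<lambda>\<omega>. iexp (\<Sum>i\<in>I j. X j i \<omega>)) - exp (- s j / 2))" for j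
  have s: "s \<longlonglongrightarrow> v" and l: "l \<longlonglongrightarrow> 0" using var lyap by (simp_all add: s_def[abs_def] l_def[abs_def])
  have bound: "E j \<le> \<eta> * s j + \<eta> powr (2 - p) * l j + (\<eta>\<^sup>2 + \<eta> powr (2 - p) * l j) * s j"
    if "\<eta> > 0" for j \<eta>
    unfolding E_def s_def l_def
    by (rule char_sum_gaussian_bound) (use assms that in auto)
  have "E \<longlonglongrightarrow> 0"
  proof (rule tendstoI)
    fix e :: real assume e: "e > 0"
    \<comment> \<open>The level \<open>\<eta>\<close> is chosen from what the bound leaves in the
      limit of large \<open>j\<close>, before any \<open>j\<close> is fixed.\<close>
    have "((\<lambda>\<eta>. \<eta> * v + \<eta>\<^sup>2 * v) \<longlongrightarrow> 0 * v + 0\<^sup>2 * v) (at_right 0)"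
      by (intro tendsto_intros)
    then have "\<forall>\<^sub>F \<eta> in at_right 0. \<eta> * v + \<eta>\<^sup>2 * v < e"
      by (rule order_tendstoD) (use e in simp)
    moreover have "\<forall>\<^sub>F \<eta>::real in at_right 0. \<eta> > 0" by (simp add: eventually_at_right_less)
    ultimately obtain \<eta> where \<eta>: "\<eta> > 0" "\<eta> * v + \<eta>\<^sup>2 * v < e"
      using eventually_happens'[OF trivial_limit_at_right_real] eventually_conj by blast
    have "(\<lambda>j. \<eta> * s j + \<eta> powr (2 - p) * l j + (\<eta>\<^sup>2 + \<eta> powr (2 - p) * l j) * s j)
        \<longlonglongrightarrow> \<eta> * v + \<eta> powr (2 - p) * 0 + (\<eta>\<^sup>2 + \<eta> powr (2 - p) * 0) * v"
      by (intro tendsto_intros s l)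
    then have "\<forall>\<^sub>F j in sequentially.
        \<eta> * s j + \<eta> powr (2 - p) * l j + (\<eta>\<^sup>2 + \<eta> powr (2 - p) * l j) * s j < e"
      by (rule order_tendstoD) (use \<eta> in simp)
    then show "\<forall>\<^sub>F j in sequentially. dist (E j) 0 < e"
    proof eventually_elim
      case (elim j)
      then show ?case using bound[OF \<eta>(1), of j] by (simp add: E_def)
    qed
  qed
  then have "(\<lambda>j. expectation (\<lambda>\<omega>. iexp (\<Sum>i\<in>I j. X j i \<omega>)) - exp (- s j / 2)) \<longlonglongrightarrow> 0"
    unfolding E_def by (rule tendsto_norm_zero_cancel)
  moreover have "(\<lambda>j. complex_of_real (exp (- s j / 2))) \<longlonglongrightarrow> exp (- v / 2)"
    by (intro tendsto_intros s) simp
  ultimately show ?thesis by (auto dest: tendsto_add)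
qed

text \<open>Splitting off one variable, the cross term vanishes because that variable is centred and
  independent of the sum of the others.\<close>

lemma (in prob_space) expectation_sum_square:
  fixes X :: "'i \<Rightarrow> 'a \<Rightarrow> real"
  assumes "finite I" "indep_vars (\<lambda>_. borel) X I"
    and "\<And>i. i \<in> I \<Longrightarrow> integrable M (\<lambda>\<omega>. (X i \<omega>)\<^sup>2)"
    and "\<And>i. i \<in> I \<Longrightarrow> expectation (X i) = 0"
  shows "integrable M (\<lambda>\<omega>. (\<Sum>i\<in>I. X i \<omega>)\<^sup>2) \<and>
    expectation (\<lambda>\<omega>. (\<Sum>i\<in>I. X i \<omega>)\<^sup>2) = (\<Sum>i\<in>I. expectation (\<lambda>\<omega>. (X i \<omega>)\<^sup>2))"
  using assms
proof (induction I)
  case empty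
  then show ?case by simp
next
  case (insert i I)
  have rv: "random_variable borel (X k)" if "k \<in> insert i I" for k
    using insert.prems(1) that unfolding indep_vars_def2 by auto
  have int: "integrable M (X k)" if "k \<in> insert i I" for k
    by (rule square_integrable_imp_integrable[OF rv[OF that] insert.prems(2)[OF that]])
  let ?S = "\<lambda>\<omega>. \<Sum>k\<in>I. X k \<omega>"
  have IH: "integrable M (\<lambda>\<omega>. (?S \<omega>)\<^sup>2)"
      "expectation (\<lambda>\<omega>. (?S \<omega>)\<^sup>2) = (\<Sum>i\<in>I. expectation (\<lambda>\<omega>. (X i \<omega>)\<^sup>2))"
    using insert.IH indep_vars_subset[OF insert.prems(1)] insert.prems by auto
  have S: "integrable M ?S" using int by auto
  have indep: "indep_var borel (X i) borel ?S"
    by (rule indep_vars_sum[OF insert.hyps insert.prems(1)])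
  have prod: "integrable M (\<lambda>\<omega>. X i \<omega> * ?S \<omega>)" "expectation (\<lambda>\<omega>. X i \<omega> * ?S \<omega>) = 0"
    using indep_var_integrable[OF indep _ S] indep_var_lebesgue_integral[OF indep _ S]
      int insert.prems(3) by auto
  have "(\<lambda>\<omega>. (\<Sum>k\<in>insert i I. X k \<omega>)\<^sup>2) = (\<lambda>\<omega>. (X i \<omega>)\<^sup>2 + 2 * (X i \<omega> * ?S \<omega>) + (?S \<omega>)\<^sup>2)"
    using insert.hyps by (simp add: power2_sum algebra_simps)
  then show ?case
    using IH prod insert.prems(2) insert.hyps by (simp add: power2_sum)
qed

subsection \<open>Gaussian vectors\<close>

lemma norm_square_eq_sum_Basis:
  fixes x :: "'b :: euclidean_space"
  shows "(norm x)\<^sup>2 = (\<Sum>b\<in>Basis. (b \<bullet> x)\<^sup>2)"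
  unfolding power2_norm_eq_inner euclidean_inner[of x x]
  by (simp only: power2_eq_square inner_commute)

lemma integrable_euclidean:
  fixes f :: "'a \<Rightarrow> 'b :: euclidean_space"
  assumes "\<And>b. b \<in> Basis \<Longrightarrow> integrable M (\<lambda>\<omega>. f \<omega> \<bullet> b)"
  shows "integrable M f"
proof -
  have "integrable M (\<lambda>\<omega>. \<Sum>b\<in>Basis. (f \<omega> \<bullet> b) *\<^sub>R b)" using assms by auto
  then show ?thesis by (simp add: euclidean_representation)
qed

text \<open>Standardising reduces this to the characteristic function of the standard normal law,
  evaluated at \<open>\<sigma>\<close>.\<close>

lemma (in prob_space) normal_iexp_expectation:
  assumes D: "distributed M lborel X (normal_density \<mu> \<sigma>)" and \<sigma>: "\<sigma> > 0"
  shows "expectation (\<lambda>\<omega>. iexp (X \<omega>)) = iexp \<mu> * exp (- \<sigma>\<^sup>2 / 2)"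
proof -
  define Z where "Z \<omega> = (X \<omega> - \<mu>) / \<sigma>" for \<omega>
  have DZ: "distributed M lborel Z std_normal_density"
    unfolding Z_def using D normal_standard_normal_convert[OF \<sigma>] by simp
  have [measurable]: "random_variable borel Z"
    using distributed_measurable[OF DZ] by simp
  have distrZ: "distr M borel Z = std_normal_distribution"
    using distributed_distr_eq_density[OF DZ] by (simp add: distr_cong[OF refl, of lborel borel])
  have "exp (- (\<sigma>\<^sup>2) / 2) = char (distr M borel Z) \<sigma>"
    unfolding distrZ char_std_normal_distribution by simp
  also have "\<dots> = expectation (\<lambda>\<omega>. iexp (\<sigma> * Z \<omega>))"
    unfolding char_def by (subst integral_distr) auto
  finally have "iexp \<mu> * exp (- \<sigma>\<^sup>2 / 2) = iexp \<mu> * expectation (\<lambda>\<omega>. iexp (\<sigma> * Z \<omega>))"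
    by simp
  also have "\<dots> = expectation (\<lambda>\<omega>. iexp \<mu> * iexp (\<sigma> * Z \<omega>))"
    by simp
  also have "\<dots> = expectation (\<lambda>\<omega>. iexp (X \<omega>))"
  proof -
    have "X \<omega> = \<mu> + \<sigma> * Z \<omega>" for \<omega>
      using \<sigma> by (simp add: Z_def)
    then show ?thesis by (simp only: of_real_add distrib_left exp_add)
  qed
  finally show ?thesis by simp
qed

lemma (in prob_space) normal_square_integrable:
  assumes D: "distributed M lborel X (normal_density \<mu> \<sigma>)" and \<sigma>: "\<sigma> > 0"
  shows "integrable M (\<lambda>\<omega>. (X \<omega>)\<^sup>2)"
proof -
  have rv[measurable]: "random_variable borel X"
    using distributed_measurable[OF D] by simp
  have "integrable M (\<lambda>\<omega>. (X \<omega> - \<mu>)\<^sup>2)"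
    using integrable_normal_moment[OF \<sigma>, of \<mu> 2]
      distributed_integrable[OF D, of "\<lambda>x. (x - \<mu>)\<^sup>2"] by simp
  moreover have "integrable M X"
    using integrable_normal_moment_nz_1[OF \<sigma>, of \<mu>] distributed_integrable[OF D, of "\<lambda>x. x"] by simp
  ultimately have "integrable M (\<lambda>\<omega>. (X \<omega> - \<mu>)\<^sup>2 + 2 * \<mu> * X \<omega> - \<mu>\<^sup>2)"
    by auto
  then show ?thesis by (simp add: power2_diff algebra_simps)
qed

lemma (in prob_space) gaussian_vector_square_integrable:
  assumes "gaussian_vector M W"
  shows "integrable M (\<lambda>\<omega>. (u \<bullet> W \<omega>)\<^sup>2)"
proof -
  have [measurable]: "random_variable borel W"
    using assms by (simp add: gaussian_vector_def)
  from assms consider \<mu> where "AE \<omega> in M. u \<bullet> W \<omega> = \<mu>"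
    | \<mu> \<sigma> where "\<sigma> > 0" "distributed M lborel (\<lambda>\<omega>. u \<bullet> W \<omega>) (normal_density \<mu> \<sigma>)"
    unfolding gaussian_vector_def by blast
  then show ?thesis
  proof cases
    case (1 \<mu>)
    have "integrable M (\<lambda>\<omega>. (u \<bullet> W \<omega>)\<^sup>2) \<longleftrightarrow> integrable M (\<lambda>\<omega>. \<mu>\<^sup>2)"
      by (rule integrable_cong_AE) (use 1 in auto)
    then show ?thesis by simp
  next
    case 2
    then show ?thesis by (intro normal_square_integrable)
  qed
qed

lemma (in prob_space) integrable_vector_of_square:
  fixes W :: "'a \<Rightarrow> 'b :: euclidean_space"
  assumes [measurable]: "random_variable borel W" and "\<And>u. integrable M (\<lambda>\<omega>. (u \<bullet> W \<omega>)\<^sup>2)"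
  shows "integrable M W"
proof (rule integrable_euclidean)
  show "integrable M (\<lambda>\<omega>. W \<omega> \<bullet> b)" for b
    by (rule square_integrable_imp_integrable) (use assms(2)[of b] in \<open>auto simp: inner_commute\<close>)
qed

text \<open>Follows the two cases of the definition. A degenerate functional is almost surely
  \<open>0\<close> since its mean is, and both sides equal \<open>1\<close>; otherwise the
  parameters \<open>\<mu>\<close> and \<open>\<sigma>\<close> are identified from the first two
  moments.\<close>

lemma (in prob_space) gaussian_vector_char:
  assumes W: "gaussian_vector M W" and mean: "expectation W = 0"
  shows "expectation (\<lambda>\<omega>. iexp (u \<bullet> W \<omega>)) = exp (- expectation (\<lambda>\<omega>. (u \<bullet> W \<omega>)\<^sup>2) / 2)"
proof -
  have rv[measurable]: "random_variable borel W"
    using W by (simp add: gaussian_vector_def)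
  have "integrable M W"
    by (rule integrable_vector_of_square[OF rv gaussian_vector_square_integrable[OF W]])
  then have mean_u: "expectation (\<lambda>\<omega>. u \<bullet> W \<omega>) = 0"
    using mean by simp
  from W consider \<mu> where "AE \<omega> in M. u \<bullet> W \<omega> = \<mu>"
    | \<mu> \<sigma> where "\<sigma> > 0" "distributed M lborel (\<lambda>\<omega>. u \<bullet> W \<omega>) (normal_density \<mu> \<sigma>)"
    unfolding gaussian_vector_def by blast
  then show ?thesis
  proof cases
    case (1 \<mu>)
    have "expectation (\<lambda>\<omega>. u \<bullet> W \<omega>) = expectation (\<lambda>_. \<mu>)"
      by (rule integral_cong_AE) (use 1 in auto)
    then have "\<mu> = 0" using mean_u by (simp add: prob_space)
    have "expectation (\<lambda>\<omega>. iexp (u \<bullet> W \<omega>)) = expectation (\<lambda>_. 1)"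
      by (rule integral_cong_AE) (use 1 \<open>\<mu> = 0\<close> in auto)
    moreover have "expectation (\<lambda>\<omega>. (u \<bullet> W \<omega>)\<^sup>2) = expectation (\<lambda>_. 0)"
      by (rule integral_cong_AE) (use 1 \<open>\<mu> = 0\<close> in auto)
    ultimately show ?thesis by (simp add: prob_space)
  next
    case (2 \<mu> \<sigma>)
    have "\<mu> = 0"
      using normal_distributed_expectation[OF 2] mean_u by simp
    moreover have "expectation (\<lambda>\<omega>. (u \<bullet> W \<omega>)\<^sup>2) = \<sigma>\<^sup>2"
      using normal_distributed_variance[OF 2] mean_u by simp
    ultimately show ?thesis
      using normal_iexp_expectation[OF 2(2,1)] by simp
  qed
qed

subsection \<open>Weak convergence in Euclidean spaces\<close>

text \<open>The class of test functions whose integrals are controlled directly by characteristic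
  functions. Monomials and sums generate it; closure under products holds because multiplying two
  characters adds their frequencies.\<close>

inductive trig_poly :: "('b :: real_inner \<Rightarrow> complex) \<Rightarrow> bool" where
  monomial: "trig_poly (\<lambda>x. c * iexp (u \<bullet> x))"
| add: "trig_poly f \<Longrightarrow> trig_poly g \<Longrightarrow> trig_poly (\<lambda>x. f x + g x)"

lemma trig_poly_const: "trig_poly (\<lambda>_. c)"
  using trig_poly.monomial[of c 0] by simp

lemma trig_poly_sum:
  assumes "finite A" "\<And>i. i \<in> A \<Longrightarrow> trig_poly (f i)"
  shows "trig_poly (\<lambda>x. \<Sum>i\<in>A. f i x)"
  using assms by (induction A) (auto intro: trig_poly_const trig_poly.add)

lemma trig_poly_monomial_mult:
  assumes "trig_poly g"
  shows "trig_poly (\<lambda>x. c * iexp (u \<bullet> x) * g x)"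
  using assms
proof induction
  case (monomial d v)
  have "(\<lambda>x. c * iexp (u \<bullet> x) * (d * iexp (v \<bullet> x))) = (\<lambda>x. (c * d) * iexp ((u + v) \<bullet> x))"
    by (simp add: inner_add_left distrib_left exp_add mult_ac)
  then show ?case by (simp only: trig_poly.monomial)
next
  case (add f g)
  then show ?case using trig_poly.add[OF add.IH] by (simp add: distrib_left)
qed

lemma trig_poly_mult:
  assumes "trig_poly f" "trig_poly g"
  shows "trig_poly (\<lambda>x. f x * g x)"
  using assms(1)
proof induction
  case (monomial c u)
  then show ?case by (rule trig_poly_monomial_mult[OF assms(2)])
next
  case (add f g)
  then show ?case using trig_poly.add[OF add.IH] by (simp add: distrib_right)
qed

lemma trig_poly_sin: "trig_poly (\<lambda>x. of_real (sin (u \<bullet> x)))"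
proof -
  have "complex_of_real (sin y) = (- \<i> / 2) * iexp y + (\<i> / 2) * iexp (- y)" for y
    by (simp add: complex_eq_iff Re_exp Im_exp)
  then have "(\<lambda>x. complex_of_real (sin (u \<bullet> x)))
      = (\<lambda>x. (- \<i> / 2) * iexp (u \<bullet> x) + (\<i> / 2) * iexp ((- u) \<bullet> x))"
    by (simp only: inner_minus_left)
  then show ?thesis by (simp only: trig_poly.intros)
qed

lemma trig_poly_integrable:
  fixes f :: "'b :: euclidean_space \<Rightarrow> complex"
  assumes "trig_poly f" "prob_space \<mu>" and [measurable_cong]: "sets \<mu> = sets borel"
  shows "integrable \<mu> f"
  using assms(1)
proof induction
  case (monomial c u)
  interpret prob_space \<mu> by fact
  have "integrable \<mu> (\<lambda>x. iexp (u \<bullet> x))"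
    by (rule integrable_iexp) auto
  then show ?case by simp
qed simp

lemma trig_poly_tendsto:
  fixes f :: "'b :: euclidean_space \<Rightarrow> complex"
  assumes f: "trig_poly f"
    and \<mu>: "\<And>n. prob_space (\<mu> n)" "\<And>n. sets (\<mu> n) = sets borel"
    and \<nu>: "prob_space \<nu>" "sets \<nu> = sets borel"
    and char: "\<And>u. (\<lambda>n. LINT x|\<mu> n. iexp (u \<bullet> x)) \<longlonglongrightarrow> (LINT x|\<nu>. iexp (u \<bullet> x))"
  shows "(\<lambda>n. LINT x|\<mu> n. f x) \<longlonglongrightarrow> (LINT x|\<nu>. f x)"
  using f
proof induction
  case (monomial c u)
  then show ?case using char[of u] by (simp add: tendsto_mult_left)
next
  case (add f g)
  have *: "integrable (\<mu> n) f" "integrable (\<mu> n) g" "integrable \<nu> f" "integrable \<nu> g" for n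
    using add \<mu> \<nu> by (auto intro: trig_poly_integrable)
  show ?case using tendsto_add[OF add.IH] by (simp add: *)
qed

section \<open>Approximation by trigonometric polynomials on a box\<close>

definition sin_vec :: "real \<Rightarrow> 'b :: euclidean_space \<Rightarrow> 'b" where
  "sin_vec a x = (\<Sum>b\<in>Basis. sin (a * (b \<bullet> x)) *\<^sub>R b)"

text \<open>Inverts \<open>sin_vec a\<close> on the box where every
  \<open>a * (b \<bullet> x)\<close> lies within \<open>pi / 2\<close> of \<open>0\<close>. Together
  the two maps identify this box with the compact cube \<open>cbox (- One) One\<close>, while
  \<open>sin_vec a\<close> sends all other points into the cube as well.\<close>

definition arcsin_vec :: "real \<Rightarrow> 'b :: euclidean_space \<Rightarrow> 'b" where
  "arcsin_vec a y = (\<Sum>b\<in>Basis. (arcsin (b \<bullet> y) / a) *\<^sub>R b)"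

lemma sin_vec_inner_Basis: "b \<in> Basis \<Longrightarrow> b \<bullet> sin_vec a x = sin (a * (b \<bullet> x))"
  by (simp add: sin_vec_def inner_sum_right inner_Basis if_distrib cong: if_cong)

lemma continuous_on_sin_vec [continuous_intros]: "continuous_on A (sin_vec a)"
  unfolding sin_vec_def[abs_def] by (intro continuous_intros)

lemma sin_vec_in_cbox: "sin_vec a x \<in> cbox (- One) One"
  using sin_vec_inner_Basis[of _ a x] by (auto simp: mem_box inner_commute[of "sin_vec a x"])

lemma continuous_on_arcsin_vec: "continuous_on (cbox (- One) One) (arcsin_vec a)"
proof -
  have "- 1 \<le> b \<bullet> y \<and> b \<bullet> y \<le> 1" if "y \<in> cbox (- One) One" "b \<in> Basis" for y b :: 'a
    using that by (auto simp: mem_box inner_commute[of b y])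
  then show ?thesis
    unfolding arcsin_vec_def[abs_def] divide_inverse by (intro continuous_intros) auto
qed

lemma arcsin_vec_sin_vec:
  assumes "a > 0" "\<And>b. b \<in> Basis \<Longrightarrow> \<bar>b \<bullet> x\<bar> \<le> pi / (2 * a)"
  shows "arcsin_vec a (sin_vec a x) = x"
proof -
  have "arcsin (b \<bullet> sin_vec a x) / a = x \<bullet> b" if b: "b \<in> Basis" for b
  proof -
    have "\<bar>a * (b \<bullet> x)\<bar> \<le> pi / 2"
      using assms(2)[OF b] assms(1) by (simp add: abs_mult field_simps)
    then have "arcsin (sin (a * (b \<bullet> x))) = a * (b \<bullet> x)"
      by (intro arcsin_sin) auto
    then show ?thesis using assms(1) b by (simp add: sin_vec_inner_Basis inner_commute)
  qed
  then show ?thesis by (simp add: arcsin_vec_def euclidean_representation)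
qed

text \<open>The coordinates of \<open>sin_vec\<close> are sines of linear functionals, hence
  trigonometric polynomials, and these form an algebra. A linear function is expanded along the
  basis.\<close>

lemma trig_poly_polynomial_sin_vec:
  fixes q :: "'b :: euclidean_space \<Rightarrow> real"
  assumes "real_polynomial_function q"
  shows "trig_poly (\<lambda>x. of_real (q (sin_vec a x)))"
  using assms
proof induction
  case (linear f)
  interpret bounded_linear f by fact
  have "complex_of_real (f (sin_vec a x))
      = (\<Sum>b\<in>Basis. of_real (f b) * of_real (sin ((a *\<^sub>R b) \<bullet> x)))" for x
    by (simp add: sin_vec_def sum scale mult.commute inner_commute)
  then show ?case
    by (simp only:) (intro trig_poly_sum finite_Basis trig_poly_mult trig_poly_const trig_poly_sin)
qed (auto intro: trig_poly_const trig_poly.add trig_poly_mult)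

text \<open>The second moment replaces an explicit tightness assumption: outside of the box on which
  \<open>f\<close> is approximated by a trigonometric polynomial, the error is charged to \<open>(norm x)\<^sup>2\<close>.\<close>

lemma trig_poly_approx:
  fixes f :: "'b :: euclidean_space \<Rightarrow> real"
  assumes f: "continuous_on UNIV f" "\<And>x. \<bar>f x\<bar> \<le> C" and e: "e > 0" and L: "L > 0"
  obtains q :: "'b \<Rightarrow> real" where "trig_poly (\<lambda>x. of_real (q x))"
    "continuous_on UNIV q" "\<And>x. \<bar>q x\<bar> \<le> C + e"
    "\<And>x. \<bar>f x - q x\<bar> \<le> e + 2 * C / L\<^sup>2 * (norm x)\<^sup>2"
proof -
  \<comment> \<open>The half-width \<open>L\<close> of the box becomes a quarter period, so sine is
    invertible exactly on the range needed.\<close>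
  define a where "a = pi / (2 * L)"
  have a: "a > 0" "pi / (2 * a) = L" using L by (simp_all add: a_def)
  have C: "C \<ge> 0" using f(2)[of 0] by linarith
  let ?g = "\<lambda>y. f (arcsin_vec a y)"
  have g: "continuous_on (cbox (- One) One) ?g"
    by (rule continuous_on_compose2[OF f(1) continuous_on_arcsin_vec]) auto
  obtain q where q: "real_polynomial_function q"
    "\<And>y. y \<in> cbox (- One) One \<Longrightarrow> \<bar>?g y - q y\<bar> < e"
    using Stone_Weierstrass_real_polynomial_function[OF compact_cbox g e] by blast
  let ?q = "\<lambda>x. q (sin_vec a x)"
  \<comment> \<open>Valid for every \<open>x\<close>: the approximated value is that of
    \<open>f\<close> at the point of the box onto which \<open>x\<close> is folded. This keeps
    \<open>?q\<close> bounded everywhere and equals \<open>f x\<close> up to \<open>e\<close> inside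
    the box.\<close>
  have close: "\<bar>f (arcsin_vec a (sin_vec a x)) - ?q x\<bar> < e" for x
    by (rule q(2)[OF sin_vec_in_cbox])
  show thesis
  proof (rule that)
    show "trig_poly (\<lambda>x. of_real (?q x))"
      by (rule trig_poly_polynomial_sin_vec[OF q(1)])
    show "continuous_on UNIV ?q"
      using continuous_real_polymonial_function[OF q(1)]
      by (intro continuous_on_compose2[OF _ continuous_on_sin_vec, of UNIV])
        (auto simp: continuous_on_eq_continuous_within continuous_at_imp_continuous_at_within)
    show "\<bar>?q x\<bar> \<le> C + e" for x
      using close[of x] f(2)[of "arcsin_vec a (sin_vec a x)"] by linarith
    show "\<bar>f x - ?q x\<bar> \<le> e + 2 * C / L\<^sup>2 * (norm x)\<^sup>2" for x
    proof (cases "\<forall>b\<in>Basis. \<bar>b \<bullet> x\<bar> \<le> L")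
      case True
      then have "arcsin_vec a (sin_vec a x) = x"
        using a by (intro arcsin_vec_sin_vec) auto
      moreover have "0 \<le> 2 * C / L\<^sup>2 * (norm x)\<^sup>2" using C by simp
      ultimately show ?thesis using close[of x] by simp
    next
      case False
      then obtain b where "b \<in> Basis" "\<bar>b \<bullet> x\<bar> > L" by (auto simp: not_le)
      then have "L \<le> norm x"
        using Basis_le_norm[of b x] by (simp add: inner_commute)
      then have "L\<^sup>2 \<le> (norm x)\<^sup>2" using L by (simp add: power_mono)
      then have "2 * C * 1 \<le> 2 * C * ((norm x)\<^sup>2 / L\<^sup>2)"
        using C L by (intro mult_left_mono) (auto simp: field_simps)
      moreover have "\<bar>f x - ?q x\<bar> \<le> 2 * C + e"
        using close[of x] f(2)[of x] f(2)[of "arcsin_vec a (sin_vec a x)"] by linarith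
      ultimately show ?thesis by simp
    qed
  qed
qed

text \<open>A single trigonometric polynomial \<open>q\<close> replaces \<open>f\<close> under all
  \<open>\<mu> n\<close> and under \<open>\<nu>\<close> at a uniformly small cost, since the second
  moments share a bound; for \<open>q\<close> itself the convergence is linearity.\<close>

theorem char_tendsto_imp_integral_tendsto:
  fixes \<mu> :: "nat \<Rightarrow> 'b :: euclidean_space measure" and f :: "'b \<Rightarrow> real"
  assumes \<mu>: "\<And>n. prob_space (\<mu> n)" "\<And>n. sets (\<mu> n) = sets borel"
    and \<nu>: "prob_space \<nu>" "sets \<nu> = sets borel"
    and \<mu>_moment: "\<And>n. integrable (\<mu> n) (\<lambda>x. (norm x)\<^sup>2)" "\<And>n. (LINT x|\<mu> n. (norm x)\<^sup>2) \<le> V"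
    and \<nu>_moment: "integrable \<nu> (\<lambda>x. (norm x)\<^sup>2)"
    and char: "\<And>u. (\<lambda>n. LINT x|\<mu> n. iexp (u \<bullet> x)) \<longlonglongrightarrow> (LINT x|\<nu>. iexp (u \<bullet> x))"
    and f: "continuous_on UNIV f" "\<And>x. \<bar>f x\<bar> \<le> C"
  shows "(\<lambda>n. LINT x|\<mu> n. f x) \<longlonglongrightarrow> (LINT x|\<nu>. f x)"
proof (rule tendstoI)
  fix \<epsilon> :: real assume \<epsilon>: "\<epsilon> > 0"
  \<comment> \<open>The budget is \<open>2 * e\<close> for replacing \<open>f\<close> by
    \<open>q\<close> under \<open>\<mu> n\<close>, the same under \<open>\<nu>\<close>, and
    \<open>e\<close> for the convergence of the integrals of \<open>q\<close>.\<close>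
  define e where "e = \<epsilon> / 5"
  define U where "U = max V (LINT x|\<nu>. (norm x)\<^sup>2)"
  have e: "e > 0" using \<epsilon> by (simp add: e_def)
  have C: "C \<ge> 0" using f(2)[of 0] by linarith
  have U: "U \<ge> 0" by (auto simp: U_def le_max_iff_disj)
  \<comment> \<open>Chosen to make \<open>2 * C / L\<^sup>2 * U \<le> e\<close>: here
    \<open>2 * C * U\<close> is \<open>e * (L - 1)\<close>, and \<open>L - 1 \<le> L\<^sup>2\<close>
    because \<open>L \<ge> 1\<close>.\<close>
  define L where "L = 1 + 2 * C * U / e"
  have L1: "L \<ge> 1" using C U e by (simp add: L_def)
  then have L: "L > 0" by simp
  have "2 * C * U = e * (L - 1)" using e by (simp add: L_def)
  also have "\<dots> \<le> e * L\<^sup>2"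
    using e L1 self_le_power[of L 2] by (intro mult_left_mono) auto
  finally have LU: "2 * C / L\<^sup>2 * U \<le> e" using L by (simp add: field_simps)
  obtain q :: "'b \<Rightarrow> real" where q: "trig_poly (\<lambda>x. of_real (q x))"
    "continuous_on UNIV q" "\<And>x. \<bar>q x\<bar> \<le> C + e"
    "\<And>x. \<bar>f x - q x\<bar> \<le> e + 2 * C / L\<^sup>2 * (norm x)\<^sup>2"
    using trig_poly_approx[OF f e L] by metis
  have [measurable]: "f \<in> borel_measurable borel" "q \<in> borel_measurable borel"
    using f(1) q(2) by (auto intro: borel_measurable_continuous_onI)
  \<comment> \<open>Stated for a generic law with second moment at most \<open>U\<close>, to serve
    both the sequence and its limit.\<close>
  have approx: "\<bar>(LINT x|\<rho>. f x) - (LINT x|\<rho>. q x)\<bar> \<le> 2 * e"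
    if \<rho>: "prob_space \<rho>" and [measurable_cong]: "sets \<rho> = sets borel"
      and m: "integrable \<rho> (\<lambda>x. (norm x)\<^sup>2)" "(LINT x|\<rho>. (norm x)\<^sup>2) \<le> U" for \<rho>
  proof -
    interpret prob_space \<rho> by fact
    have i: "integrable \<rho> f" "integrable \<rho> q"
      using f(2) q(3)
      by (auto intro: integrable_const_bound[where B = C] integrable_const_bound[where B = "C + e"])
    have "\<bar>(LINT x|\<rho>. f x) - (LINT x|\<rho>. q x)\<bar> = \<bar>LINT x|\<rho>. f x - q x\<bar>"
      using i by simp
    also have "\<dots> \<le> (LINT x|\<rho>. \<bar>f x - q x\<bar>)" by (rule integral_abs_bound)
    also have "\<dots> \<le> (LINT x|\<rho>. e + 2 * C / L\<^sup>2 * (norm x)\<^sup>2)"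
      by (rule integral_mono) (use i m q(4) in auto)
    also have "\<dots> = e + 2 * C / L\<^sup>2 * (LINT x|\<rho>. (norm x)\<^sup>2)"
      using m by (simp add: prob_space)
    also have "\<dots> \<le> e + 2 * C / L\<^sup>2 * U"
      using m C by (intro add_left_mono mult_left_mono) auto
    finally show ?thesis using LU by linarith
  qed
  have "(\<lambda>n. LINT x|\<mu> n. complex_of_real (q x)) \<longlonglongrightarrow> (LINT x|\<nu>. complex_of_real (q x))"
    by (rule trig_poly_tendsto[OF q(1) \<mu> \<nu> char])
  then have "(\<lambda>n. LINT x|\<mu> n. q x) \<longlonglongrightarrow> (LINT x|\<nu>. q x)"
    by (simp add: tendsto_of_real_iff)
  then have "\<forall>\<^sub>F n in sequentially. dist (LINT x|\<mu> n. q x) (LINT x|\<nu>. q x) < e"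
    using e by (rule tendstoD)
  then show "\<forall>\<^sub>F n in sequentially. dist (LINT x|\<mu> n. f x) (LINT x|\<nu>. f x) < \<epsilon>"
  proof eventually_elim
    case (elim n)
    have "\<bar>(LINT x|\<mu> n. f x) - (LINT x|\<mu> n. q x)\<bar> \<le> 2 * e"
      using \<mu> \<mu>_moment by (intro approx) (auto simp: U_def le_max_iff_disj)
    moreover have "\<bar>(LINT x|\<nu>. f x) - (LINT x|\<nu>. q x)\<bar> \<le> 2 * e"
      using \<nu> \<nu>_moment by (intro approx) (auto simp: U_def)
    ultimately show ?case using elim unfolding dist_real_def e_def by linarith
  qed
qed

section \<open>From continuous test functions to continuity sets\<close>

lemma closed_approx_tendsto:
  fixes x :: "'b :: metric_space"
  assumes "closed F" "F \<noteq> {}"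
  shows "(\<lambda>m. max 0 (1 - real m * infdist x F)) \<longlonglongrightarrow> indicator F x"
proof (cases "x \<in> F")
  case True
  then show ?thesis by simp
next
  case False
  then have d: "infdist x F > 0"
    using assms in_closed_iff_infdist_zero[of F x] infdist_nonneg[of x F] by force
  have "filterlim (\<lambda>m. real m * infdist x F) at_top sequentially"
    using filterlim_tendsto_pos_mult_at_top[OF tendsto_const d filterlim_real_sequentially]
    by (simp add: mult.commute)
  then have "\<forall>\<^sub>F m in sequentially. real m * infdist x F \<ge> 1"
    by (simp add: filterlim_at_top)
  then have "\<forall>\<^sub>F m in sequentially. max 0 (1 - real m * infdist x F) = indicator F x"
    by eventually_elim (use False in auto)
  then show ?thesis by (rule tendsto_eventually)
qed

text \<open>The cutoffs \<open>f m\<close> dominate the indicator of \<open>F\<close> and converge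
  to it. An index \<open>m\<close> is first fixed so that the integral under \<open>\<nu>\<close> is
  below \<open>e\<close>; weak convergence for this one function then bounds
  \<open>measure (\<mu> n) F\<close>.\<close>

lemma portmanteau_closed:
  fixes \<mu> :: "nat \<Rightarrow> 'b :: metric_space measure"
  assumes \<mu>: "\<And>n. prob_space (\<mu> n)" "\<And>n. sets (\<mu> n) = sets borel"
    and \<nu>: "prob_space \<nu>" "sets \<nu> = sets borel"
    and weak: "\<And>f :: 'b \<Rightarrow> real. continuous_on UNIV f \<Longrightarrow> (\<And>x. \<bar>f x\<bar> \<le> 1) \<Longrightarrow>
      (\<lambda>n. LINT x|\<mu> n. f x) \<longlonglongrightarrow> (LINT x|\<nu>. f x)"
    and F: "closed F" and e: "measure \<nu> F < e"
  shows "\<forall>\<^sub>F n in sequentially. measure (\<mu> n) F < e"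
\<comment> \<open>\<open>infdist\<close> to the empty set is \<open>0\<close> by convention, so the
  cutoffs would be constantly \<open>1\<close> there.\<close>
proof (cases "F = {}")
  case True
  then show ?thesis using e by simp
next
  case False
  interpret \<nu>: prob_space \<nu> by fact
  note [measurable_cong] = \<mu>(2) \<nu>(2)
  define f where "f m x = max 0 (1 - real m * infdist x F)" for m :: nat and x
  have cont: "continuous_on UNIV (f m)" for m
    unfolding f_def[abs_def] by (intro continuous_intros)
  have [measurable]: "f m \<in> borel_measurable borel" for m
    using cont by (rule borel_measurable_continuous_onI)
  have [measurable]: "F \<in> sets borel" using F by simp
  have le1: "\<bar>f m x\<bar> \<le> 1" for m x
    using infdist_nonneg[of x F] by (auto simp: f_def max_def)
  have "(\<lambda>m. LINT x|\<nu>. f m x) \<longlonglongrightarrow> (LINT x|\<nu>. indicator F x)"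
  proof (rule integral_dominated_convergence[where w = "\<lambda>_. 1"])
    show "AE x in \<nu>. (\<lambda>m. f m x) \<longlonglongrightarrow> indicator F x"
      using closed_approx_tendsto[OF F False] by (simp add: f_def)
  qed (use le1 in auto)
  also have "(LINT x|\<nu>. indicator F x) = measure \<nu> F"
    by (simp add: \<nu>(2) sets_eq_imp_space_eq[OF \<nu>(2)])
  finally have "\<forall>\<^sub>F m in sequentially. (LINT x|\<nu>. f m x) < e"
    using e by (rule order_tendstoD)
  then obtain m where "(LINT x|\<nu>. f m x) < e"
    using eventually_happens'[OF sequentially_bot] by blast
  then have "\<forall>\<^sub>F n in sequentially. (LINT x|\<mu> n. f m x) < e"
    by (rule order_tendstoD(2)[OF weak[OF cont le1]])
  then show ?thesis
  proof eventually_elim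
    case (elim n)
    interpret prob_space "\<mu> n" by (rule \<mu>)
    have "measure (\<mu> n) F = (LINT x|\<mu> n. indicator F x)"
      by (simp add: sets_eq_imp_space_eq[OF \<mu>(2)])
    also have "\<dots> \<le> (LINT x|\<mu> n. f m x)"
    proof (rule integral_mono)
      show "integrable (\<mu> n) (f m)"
        using le1 by (intro integrable_const_bound[where B = 1]) auto
      show "indicator F x \<le> f m x" for x
        by (cases "x \<in> F") (auto simp: f_def)
      show "integrable (\<mu> n) (indicator F :: 'b \<Rightarrow> real)"
        by (intro integrable_const_bound[where B = 1]) (auto simp: indicator_def)
    qed
    finally show ?case using elim by simp
  qed
qed

text \<open>Closing a continuity set does not change its limit measure, so the closed case gives the
  upper bound. The lower bound is the upper bound for the complement, which has the same
  frontier.\<close>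

theorem portmanteau_continuity_set:
  fixes \<mu> :: "nat \<Rightarrow> 'b :: metric_space measure"
  assumes \<mu>: "\<And>n. prob_space (\<mu> n)" "\<And>n. sets (\<mu> n) = sets borel"
    and \<nu>: "prob_space \<nu>" "sets \<nu> = sets borel"
    and weak: "\<And>f :: 'b \<Rightarrow> real. continuous_on UNIV f \<Longrightarrow> (\<And>x. \<bar>f x\<bar> \<le> 1) \<Longrightarrow>
      (\<lambda>n. LINT x|\<mu> n. f x) \<longlonglongrightarrow> (LINT x|\<nu>. f x)"
    and B: "B \<in> sets borel" "measure \<nu> (frontier B) = 0"
  shows "(\<lambda>n. measure (\<mu> n) B) \<longlonglongrightarrow> measure \<nu> B"
proof (rule order_tendstoI)
  interpret \<nu>: prob_space \<nu> by fact
  have frontier_upper: "measure \<nu> (closure A) \<le> measure \<nu> A"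
    if "A \<in> sets borel" "measure \<nu> (frontier A) = 0" for A
  proof -
    have "measure \<nu> (closure A) \<le> measure \<nu> (A \<union> frontier A)"
      using that \<nu>(2) closure_Un_frontier[of A] by (intro \<nu>.finite_measure_mono) auto
    also have "\<dots> \<le> measure \<nu> A + measure \<nu> (frontier A)"
      using that \<nu>(2) by (intro measure_Un_le) auto
    finally show ?thesis using that by simp
  qed
  have upper: "\<forall>\<^sub>F n in sequentially. measure (\<mu> n) A < e"
    if A: "A \<in> sets borel" "measure \<nu> (frontier A) = 0" and e: "measure \<nu> A < e" for A e
  proof -
    have "\<forall>\<^sub>F n in sequentially. measure (\<mu> n) (closure A) < e"
      using frontier_upper[OF A] e
      by (intro portmanteau_closed[OF \<mu> \<nu> weak]) auto
    then show ?thesis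
    proof eventually_elim
      case (elim n)
      interpret prob_space "\<mu> n" by (rule \<mu>)
      have "measure (\<mu> n) A \<le> measure (\<mu> n) (closure A)"
        using \<mu>(2) closure_subset by (intro finite_measure_mono) auto
      then show ?case using elim by simp
    qed
  qed
  show "\<forall>\<^sub>F n in sequentially. measure (\<mu> n) B < e" if "measure \<nu> B < e" for e
    using upper[OF B that] .
  have compl: "measure \<rho> (- B) = 1 - measure \<rho> B" if "prob_space \<rho>" "sets \<rho> = sets borel" for \<rho>
    using prob_space.prob_compl[OF that(1), of B] B that(2) sets_eq_imp_space_eq[OF that(2)]
    by (simp add: Compl_eq_Diff_UNIV)
  show "\<forall>\<^sub>F n in sequentially. e < measure (\<mu> n) B" if e: "e < measure \<nu> B" for e
  proof -
    have "\<forall>\<^sub>F n in sequentially. measure (\<mu> n) (- B) < 1 - e"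
      using B e compl[OF \<nu>] by (intro upper) (auto simp: frontier_complement)
    then show ?thesis
      by eventually_elim (use compl[OF \<mu>] in auto)
  qed
qed

subsection \<open>Conditioning on a random index\<close>

lemma subalgebra_sigma_gen:
  "X \<in> measurable M N \<Longrightarrow> subalgebra M (sigma_gen M N X)"
  unfolding subalgebra_def sigma_gen_def
  using sets_image_in_sets[of M "space M" X N] by simp

lemma measurable_sigma_gen: "X \<in> measurable M N \<Longrightarrow> X \<in> measurable (sigma_gen M N X) N"
  unfolding sigma_gen_def by (rule measurable_vimage_algebra1) (auto dest: measurable_space)

text \<open>The constant \<open>prob A\<close> is measurable for \<open>F\<close>, and independence
  says that it has the same integral as the indicator over every set of \<open>F\<close>; this
  characterises the conditional expectation.\<close>

lemma (in prob_space) real_cond_exp_indep_event: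
  assumes F: "subalgebra M F" and A: "A \<in> events"
    and indep: "\<And>C. C \<in> sets F \<Longrightarrow> prob (C \<inter> A) = prob C * prob A"
  shows "AE \<omega> in M. real_cond_exp M F (indicator A) \<omega> = prob A"
proof -
  interpret finite_measure_subalgebra M F
    by (unfold_locales) (rule F)
  show ?thesis
  proof (rule real_cond_exp_charact)
    fix C assume C: "C \<in> sets F"
    then have CM: "C \<in> events" using F by (auto simp: subalgebra_def)
    have "(LINT x:C|M. indicator A x) = (LINT x|M. indicator (C \<inter> A) x)"
      unfolding set_lebesgue_integral_def
      by (intro Bochner_Integration.integral_cong) (auto simp: indicator_def)
    also have "\<dots> = prob C * prob A"
      using CM A by (simp add: indep[OF C])
    also have "\<dots> = (LINT x:C|M. prob A)"
      using CM by (simp add: set_lebesgue_integral_def)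
    finally show "(LINT x:C|M. indicator A x) = (LINT x:C|M. prob A)" .
  qed (use A in \<open>auto simp: integrable_indicator_iff emeasure_eq_measure\<close>)
qed

text \<open>On \<open>{K = m}\<close> the random-index event agrees with the event \<open>A m\<close>, so multiplying by the
  \<open>K\<close>-measurable indicator of \<open>{K = m}\<close> reduces everything to a fixed index.\<close>

lemma (in prob_space) cond_prob_given_random_index:
  fixes K :: "'a \<Rightarrow> nat" and A :: "nat \<Rightarrow> 'a set"
  assumes K[measurable]: "random_variable (count_space UNIV) K"
    and A[measurable]: "\<And>m. A m \<in> events"
    and indep: "\<And>C m. C \<in> sets (sigma_gen M (count_space UNIV) K) \<Longrightarrow>
      prob (C \<inter> A m) = prob C * prob (A m)"
    and P: "\<And>\<omega>. \<omega> \<in> space M \<Longrightarrow> P \<omega> \<longleftrightarrow> \<omega> \<in> A (K \<omega>)"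
  shows "AE \<omega> in M. cond_prob_given M P K \<omega> = prob (A (K \<omega>))"
proof -
  define F where "F = sigma_gen M (count_space UNIV) K"
  define E where "E = {\<omega> \<in> space M. P \<omega>}"
  have F: "subalgebra M F" unfolding F_def by (rule subalgebra_sigma_gen[OF K])
  interpret finite_measure_subalgebra M F
    by (unfold_locales) (rule F)
  have "E = {\<omega> \<in> space M. \<exists>m. K \<omega> = m \<and> \<omega> \<in> A m}" using P by (auto simp: E_def)
  also have "\<dots> \<in> events" by measurable
  finally have E[measurable]: "E \<in> events" .
  have KF[measurable]: "K \<in> measurable F (count_space UNIV)"
    unfolding F_def by (rule measurable_sigma_gen[OF K])
  have "AE \<omega> in M. K \<omega> = m \<longrightarrow> real_cond_exp M F (indicator E) \<omega> = prob (A m)" for m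
  proof -
    define J :: "'a \<Rightarrow> real" where "J \<omega> = indicator {m} (K \<omega>)" for \<omega>
    have J[measurable]: "J \<in> borel_measurable F"
      unfolding J_def[abs_def] by (rule measurable_compose[OF KF]) simp
    have JM[measurable]: "J \<in> borel_measurable M"
      by (rule measurable_from_subalg[OF F J])
    have int: "integrable M (\<lambda>\<omega>. J \<omega> * indicator D \<omega>)" if [measurable]: "D \<in> events" for D
      by (rule integrable_const_bound[where B = 1]) (auto simp: J_def indicator_def)
    have "AE \<omega> in M. real_cond_exp M F (\<lambda>\<omega>. J \<omega> * indicator E \<omega>) \<omega> = J \<omega> * real_cond_exp M F (indicator E) \<omega>"
      by (rule real_cond_exp_mult) (auto intro: int)
    moreover have "AE \<omega> in M. real_cond_exp M F (\<lambda>\<omega>. J \<omega> * indicator (A m) \<omega>) \<omega>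
        = J \<omega> * real_cond_exp M F (indicator (A m)) \<omega>"
      by (rule real_cond_exp_mult) (auto intro: int)
    moreover have "AE \<omega> in M. real_cond_exp M F (\<lambda>\<omega>. J \<omega> * indicator E \<omega>) \<omega>
        = real_cond_exp M F (\<lambda>\<omega>. J \<omega> * indicator (A m) \<omega>) \<omega>"
    proof (rule real_cond_exp_cong)
      show "AE \<omega> in M. J \<omega> * indicator E \<omega> = J \<omega> * indicator (A m) \<omega>"
        by (rule AE_I2) (auto simp: J_def E_def P indicator_def)
    qed auto
    moreover have "AE \<omega> in M. real_cond_exp M F (indicator (A m)) \<omega> = prob (A m)"
      using indep by (intro real_cond_exp_indep_event F) (auto simp: F_def)
    ultimately show ?thesis
      by eventually_elim (auto simp: J_def)
  qed
  \<comment> \<open>The index takes countably many values, so the exceptional null sets merge into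
    one.\<close>
  then have "AE \<omega> in M. \<forall>m. K \<omega> = m \<longrightarrow> real_cond_exp M F (indicator E) \<omega> = prob (A m)"
    unfolding AE_all_countable by blast
  then show ?thesis
    unfolding cond_prob_given_def F_def[symmetric] E_def[symmetric] by eventually_elim simp
qed

subsection \<open>Covariance matrices and variances of linear functionals\<close>

lemma integral_vec_nth:
  fixes f :: "'a \<Rightarrow> ('b :: euclidean_space) ^ 'n"
  shows "integrable M f \<Longrightarrow> (LINT \<omega>|M. f \<omega>) $ i = (LINT \<omega>|M. f \<omega> $ i)"
  by (rule integral_bounded_linear[OF bounded_linear_vec_nth, symmetric])

lemma integrable_matrix:
  fixes f :: "'a \<Rightarrow> complex ^ 'n ^ 'm"
  assumes "\<And>i k. integrable M (\<lambda>\<omega>. f \<omega> $ i $ k)"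
  shows "integrable M f"
  by (rule integrable_euclidean) (simp add: inner_vec_def assms)

lemma integral_matrix_nth:
  fixes f :: "'a \<Rightarrow> complex ^ 'n ^ 'm"
  assumes "\<And>i k. integrable M (\<lambda>\<omega>. f \<omega> $ i $ k)"
  shows "(LINT \<omega>|M. f \<omega>) $ i $ k = (LINT \<omega>|M. f \<omega> $ i $ k)"
proof -
  have f: "integrable M f" by (rule integrable_matrix[OF assms])
  have "integrable M (\<lambda>\<omega>. f \<omega> $ i)"
    by (rule integrable_bounded_linear[OF bounded_linear_vec_nth f])
  then show ?thesis by (simp add: integral_vec_nth f)
qed

lemma columnvector_rowvector_nth: 
  "((columnvector v :: 'a :: semiring_1 ^ 1 ^ 'm) ** (rowvector w :: 'a ^ 'n ^ 1)) $ i $ k = v $ i * w $ k"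
  by (simp add: columnvector_def rowvector_def matrix_matrix_mult_def)

lemma bounded_linear_cnj_vec: "bounded_linear cnj_vec"
  unfolding linear_conv_bounded_linear[symmetric]
  by (rule linearI) (simp_all add: cnj_vec_def vec_eq_iff)

text \<open>For \<open>C1\<close> the covariance of \<open>X\<close> with itself and
  \<open>C2\<close> that of \<open>X\<close> with its conjugate, this is the variance of the real
  functional \<open>u \<bullet> X\<close>. The conjugates on \<open>u\<close> come from the real
  inner product on complex vectors.\<close>

definition cov_quad :: "complex ^ 'd \<Rightarrow> complex ^ 'd ^ 'd \<Rightarrow> complex ^ 'd ^ 'd \<Rightarrow> real" where
  "cov_quad u C1 C2 =
     (\<Sum>i\<in>UNIV. \<Sum>k\<in>UNIV. Re (cnj (u $ i) * cnj (u $ k) * C1 $ i $ k + cnj (u $ i) * u $ k * C2 $ i $ k)) / 2"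

lemma cov_quad_sum:
  "cov_quad u (\<Sum>a\<in>A. f a) (\<Sum>a\<in>A. g a) = (\<Sum>a\<in>A. cov_quad u (f a) (g a))"
proof (induction A rule: infinite_finite_induct)
  case (insert a A)
  have "cov_quad u (C + C') (D + D') = cov_quad u C D + cov_quad u C' D'" for C C' D D'
    unfolding cov_quad_def add_divide_distrib[symmetric] sum.distrib[symmetric]
    by (simp add: algebra_simps)
  then show ?case using insert by simp
qed (simp_all add: cov_quad_def)

lemma tendsto_cov_quad:
  assumes "(f \<longlongrightarrow> C) F" "(g \<longlongrightarrow> D) F"
  shows "((\<lambda>x. cov_quad u (f x) (g x)) \<longlongrightarrow> cov_quad u C D) F"
  unfolding cov_quad_def by (intro tendsto_intros assms) simp

text \<open>From \<open>(Re z)\<^sup>2 = Re (z\<^sup>2 + z * cnj z) / 2\<close> with \<open>z\<close> the Hermitian product of \<open>u\<close> and \<open>x\<close>.\<close>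

lemma inner_square_eq_cov_quad:
  fixes u x :: "complex ^ 'd"
  shows "(u \<bullet> x)\<^sup>2 = cov_quad u ((columnvector x :: complex ^ 1 ^ 'd) ** (rowvector x :: complex ^ 'd ^ 1))
    ((columnvector x :: complex ^ 1 ^ 'd) ** (rowvector (cnj_vec x) :: complex ^ 'd ^ 1))"
proof -
  define z where "z = (\<Sum>i\<in>UNIV. cnj (u $ i) * x $ i)"
  have "u \<bullet> x = Re z" by (simp add: inner_vec_def inner_complex_def z_def)
  moreover have "(Re z)\<^sup>2 = Re (z * z + z * cnj z) / 2"
    by (simp add: power2_eq_square)
  moreover have "z * z + z * cnj z = (\<Sum>i\<in>UNIV. \<Sum>k\<in>UNIV.
      cnj (u $ i) * cnj (u $ k) * (x $ i * x $ k) + cnj (u $ i) * u $ k * (x $ i * cnj (x $ k)))"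
    unfolding z_def cnj_sum sum_product sum.distrib[symmetric] by (simp add: mult_ac)
  ultimately show ?thesis
    by (simp add: cov_quad_def columnvector_rowvector_nth cnj_vec_def)
qed

lemma integral_cov_quad:
  fixes f g :: "'a \<Rightarrow> complex ^ 'd ^ 'd"
  assumes f: "\<And>i k. integrable M (\<lambda>\<omega>. f \<omega> $ i $ k)" and g: "\<And>i k. integrable M (\<lambda>\<omega>. g \<omega> $ i $ k)"
  shows "(LINT \<omega>|M. cov_quad u (f \<omega>) (g \<omega>)) = cov_quad u (integral\<^sup>L M f) (integral\<^sup>L M g)"
proof -
  have h: "integrable M (\<lambda>\<omega>. c * f \<omega> $ i $ k + d * g \<omega> $ i $ k)" for c d i k
    using f g by auto
  have "(LINT \<omega>|M. Re (c * f \<omega> $ i $ k + d * g \<omega> $ i $ k))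
      = Re (c * (integral\<^sup>L M f) $ i $ k + d * (integral\<^sup>L M g) $ i $ k)" for c d i k
    using integral_Re[OF h, of c i k d] f g
    by (simp only: integral_matrix_nth[OF f] integral_matrix_nth[OF g])
      (simp add: integral_add integral_mult_right)
  then show ?thesis
    unfolding cov_quad_def using h
    by (simp add: Bochner_Integration.integral_sum del: plus_complex.sel)
qed

text \<open>The pointwise identity for \<open>(u \<bullet> D \<omega>)\<^sup>2\<close> is
  integrated. Products of two entries are dominated by the integrable squared norm, and conjugation,
  being real linear and bounded, commutes with centring.\<close>

lemma (in prob_space) variance_inner_eq_cov_quad:
  fixes X :: "'a \<Rightarrow> complex ^ 'd"
  assumes rv[measurable]: "random_variable borel X"
    and sq: "integrable M (\<lambda>\<omega>. (norm (X \<omega> - expectation X))\<^sup>2)" and int: "integrable M X"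
  shows "expectation (\<lambda>\<omega>. (u \<bullet> (X \<omega> - expectation X))\<^sup>2)
    = cov_quad u (Cov M X X) (Cov M X (\<lambda>\<omega>. cnj_vec (X \<omega>)))"
proof -
  define D where "D \<omega> = X \<omega> - expectation X" for \<omega>
  have D[measurable]: "random_variable borel D" unfolding D_def[abs_def] by measurable
  have Dnth[measurable]: "(\<lambda>\<omega>. D \<omega> $ i) \<in> borel_measurable M" for i
    by (rule measurable_compose[OF D]) (intro borel_measurable_continuous_onI continuous_intros)
  have [measurable]: "(\<lambda>\<omega>. cnj (D \<omega> $ i)) \<in> borel_measurable M" for i
    by (rule measurable_compose[OF Dnth]) (intro borel_measurable_continuous_onI continuous_intros)
  have le: "norm (D \<omega> $ i) * norm (D \<omega> $ k) \<le> (norm (D \<omega>))\<^sup>2" for \<omega> i k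
    unfolding power2_eq_square by (intro mult_mono) (auto simp: Finite_Cartesian_Product.norm_nth_le)
  have m1: "integrable M (\<lambda>\<omega>. D \<omega> $ i * D \<omega> $ k)" for i k
    by (rule Bochner_Integration.integrable_bound[OF sq[folded D_def]])
      (use le in \<open>auto simp: norm_mult\<close>)
  have m2: "integrable M (\<lambda>\<omega>. D \<omega> $ i * cnj (D \<omega> $ k))" for i k
    by (rule Bochner_Integration.integrable_bound[OF sq[folded D_def]])
      (use le in \<open>auto simp: norm_mult\<close>)
  interpret cnj_vec: bounded_linear cnj_vec by (rule bounded_linear_cnj_vec)
  have cnj: "cnj_vec (X \<omega>) - expectation (\<lambda>\<omega>. cnj_vec (X \<omega>)) = cnj_vec (D \<omega>)" for \<omega>
    by (simp add: integral_bounded_linear[OF bounded_linear_cnj_vec int] D_def cnj_vec.diff)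
  have "expectation (\<lambda>\<omega>. (u \<bullet> D \<omega>)\<^sup>2) = expectation (\<lambda>\<omega>. cov_quad u
      ((columnvector (D \<omega>) :: complex ^ 1 ^ 'd) ** (rowvector (D \<omega>) :: complex ^ 'd ^ 1))
      ((columnvector (D \<omega>) :: complex ^ 1 ^ 'd) ** (rowvector (cnj_vec (D \<omega>)) :: complex ^ 'd ^ 1)))"
    by (simp only: inner_square_eq_cov_quad)
  also have "\<dots> = cov_quad u (Cov M X X) (Cov M X (\<lambda>\<omega>. cnj_vec (X \<omega>)))"
    unfolding Cov_def cnj unfolding D_def[symmetric]
    by (rule integral_cov_quad) (use m1 m2 in \<open>simp_all add: columnvector_rowvector_nth cnj_vec_def\<close>)
  finally show ?thesis unfolding D_def .
qed

subsection \<open>The multivariate Lyapunov theorem\<close>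

lemma (in prob_space) integrable_of_norm_square:
  fixes X :: "'a \<Rightarrow> 'b :: {banach, second_countable_topology}"
  assumes [measurable]: "random_variable borel X" and "integrable M (\<lambda>\<omega>. (norm (X \<omega>))\<^sup>2)"
  shows "integrable M X"
proof -
  have "integrable M (\<lambda>\<omega>. norm (X \<omega>))"
    by (rule square_integrable_imp_integrable) (use assms in auto)
  then show ?thesis by (simp add: integrable_norm_iff)
qed

text \<open>Every functional \<open>u \<bullet> X j i\<close> inherits the one-dimensional
  hypotheses, its \<open>p\<close>-th moments growing by at most \<open>norm u powr p\<close>. So
  all characteristic functions converge, and the weak convergence criterion applies to the laws of
  the row sums; \<open>W\<close> enters only through its law and may live on another space.\<close>

theorem (in prob_space) lyapunov_clt:
  fixes X :: "nat \<Rightarrow> 'i \<Rightarrow> 'a \<Rightarrow> 'b :: euclidean_space" and I :: "nat \<Rightarrow> 'i set" and p :: real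
    and W :: "'c \<Rightarrow> 'b"
  assumes fin: "\<And>j. finite (I j)" and indep: "\<And>j. indep_vars (\<lambda>_. borel) (X j) (I j)"
    and sq: "\<And>i j. i \<in> I j \<Longrightarrow> integrable M (\<lambda>\<omega>. (norm (X j i \<omega>))\<^sup>2)"
    and mean: "\<And>i j. i \<in> I j \<Longrightarrow> expectation (X j i) = 0"
    and mom: "\<And>i j. i \<in> I j \<Longrightarrow> integrable M (\<lambda>\<omega>. norm (X j i \<omega>) powr p)"
    and p: "p > 2"
    and N: "prob_space N" and W: "gaussian_vector N W" and W_mean: "integral\<^sup>L N W = 0"
    and var: "\<And>u. (\<lambda>j. \<Sum>i\<in>I j. expectation (\<lambda>\<omega>. (u \<bullet> X j i \<omega>)\<^sup>2)) \<longlonglongrightarrow> (LINT \<omega>|N. (u \<bullet> W \<omega>)\<^sup>2)"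
    and lyap: "(\<lambda>j. \<Sum>i\<in>I j. expectation (\<lambda>\<omega>. norm (X j i \<omega>) powr p)) \<longlonglongrightarrow> 0"
    and B: "continuity_set N W B"
  shows "(\<lambda>j. prob {\<omega> \<in> space M. (\<Sum>i\<in>I j. X j i \<omega>) \<in> B}) \<longlonglongrightarrow> measure N {\<omega> \<in> space N. W \<omega> \<in> B}"
proof -
  interpret N: prob_space N by fact
  define S where "S j \<omega> = (\<Sum>i\<in>I j. X j i \<omega>)" for j \<omega>
  have rv[measurable]: "random_variable borel (X j i)" if "i \<in> I j" for i j
    using indep that unfolding indep_vars_def2 by blast
  have S[measurable]: "random_variable borel (S j)" for j
    unfolding S_def[abs_def] by measurable
  have Wm[measurable]: "W \<in> borel_measurable N"
    using W by (simp add: gaussian_vector_def)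
  have int: "integrable M (X j i)" if "i \<in> I j" for i j
    by (rule integrable_of_norm_square[OF rv[OF that] sq[OF that]])
  have uS: "u \<bullet> S j \<omega> = (\<Sum>i\<in>I j. u \<bullet> X j i \<omega>)" for u j \<omega>
    by (simp add: S_def inner_sum_right)
  have u_indep: "indep_vars (\<lambda>_. borel) (\<lambda>i \<omega>. u \<bullet> X j i \<omega>) (I j)" for u j
    by (rule indep_vars_compose2[OF indep]) simp
  have u_sq: "integrable M (\<lambda>\<omega>. (u \<bullet> X j i \<omega>)\<^sup>2)" if i: "i \<in> I j" for u j i
  proof (rule Bochner_Integration.integrable_bound)
    show "integrable M (\<lambda>\<omega>. (norm u)\<^sup>2 * (norm (X j i \<omega>))\<^sup>2)" using sq[OF i] by simp
    show "AE \<omega> in M. norm ((u \<bullet> X j i \<omega>)\<^sup>2) \<le> norm ((norm u)\<^sup>2 * (norm (X j i \<omega>))\<^sup>2)"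
      by (simp add: Cauchy_Schwarz_ineq power_mult_distrib[symmetric] power2_norm_eq_inner)
  qed (use i in measurable)
  have u_mean: "expectation (\<lambda>\<omega>. u \<bullet> X j i \<omega>) = 0" if "i \<in> I j" for u j i
    using int[OF that] mean[OF that] by simp
  have powr_le: "\<bar>u \<bullet> x\<bar> powr p \<le> norm u powr p * norm x powr p" for u x :: 'b
    using p by (simp add: Cauchy_Schwarz_ineq2 powr_mono2 flip: powr_mult)
  have u_mom: "integrable M (\<lambda>\<omega>. \<bar>u \<bullet> X j i \<omega>\<bar> powr p)" if i: "i \<in> I j" for u j i
  proof (rule Bochner_Integration.integrable_bound)
    show "integrable M (\<lambda>\<omega>. norm u powr p * norm (X j i \<omega>) powr p)" using mom[OF i] by simp
  qed (use i powr_le in auto)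
  have u_lyap: "(\<lambda>j. \<Sum>i\<in>I j. expectation (\<lambda>\<omega>. \<bar>u \<bullet> X j i \<omega>\<bar> powr p)) \<longlonglongrightarrow> 0" for u
  proof (rule tendsto_sandwich[OF always_eventually always_eventually tendsto_const])
    show "\<forall>j. 0 \<le> (\<Sum>i\<in>I j. expectation (\<lambda>\<omega>. \<bar>u \<bullet> X j i \<omega>\<bar> powr p))"
      by (auto intro: sum_nonneg)
    show "\<forall>j. (\<Sum>i\<in>I j. expectation (\<lambda>\<omega>. \<bar>u \<bullet> X j i \<omega>\<bar> powr p))
        \<le> norm u powr p * (\<Sum>i\<in>I j. expectation (\<lambda>\<omega>. norm (X j i \<omega>) powr p))"
    proof
      fix j
      have "expectation (\<lambda>\<omega>. \<bar>u \<bullet> X j i \<omega>\<bar> powr p) \<le> norm u powr p * expectation (\<lambda>\<omega>. norm (X j i \<omega>) powr p)"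
        if i: "i \<in> I j" for i
        using integral_mono[OF u_mom[OF i] _ powr_le] mom[OF i] by simp
      then show "(\<Sum>i\<in>I j. expectation (\<lambda>\<omega>. \<bar>u \<bullet> X j i \<omega>\<bar> powr p))
          \<le> norm u powr p * (\<Sum>i\<in>I j. expectation (\<lambda>\<omega>. norm (X j i \<omega>) powr p))"
        unfolding sum_distrib_left by (rule sum_mono)
    qed
    show "(\<lambda>j. norm u powr p * (\<Sum>i\<in>I j. expectation (\<lambda>\<omega>. norm (X j i \<omega>) powr p))) \<longlonglongrightarrow> 0"
      using tendsto_mult_left[OF lyap, of "norm u powr p"] by simp
  qed
  have char: "(\<lambda>j. expectation (\<lambda>\<omega>. iexp (u \<bullet> S j \<omega>))) \<longlonglongrightarrow> (LINT \<omega>|N. iexp (u \<bullet> W \<omega>))" for u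
    unfolding N.gaussian_vector_char[OF W W_mean] uS
    by (rule lyapunov_char_limit[OF fin u_indep u_sq u_mean u_mom p var u_lyap])
  have u_S: "integrable M (\<lambda>\<omega>. (u \<bullet> S j \<omega>)\<^sup>2)"
      "expectation (\<lambda>\<omega>. (u \<bullet> S j \<omega>)\<^sup>2) = (\<Sum>i\<in>I j. expectation (\<lambda>\<omega>. (u \<bullet> X j i \<omega>)\<^sup>2))" for u j
    using expectation_sum_square[OF fin u_indep u_sq u_mean] by (simp_all add: uS)
  \<comment> \<open>The second moments of the row sums are sums of coordinate variances and
    converge, hence are bounded. The bound \<open>V\<close> stands in for tightness.\<close>
  have "(\<lambda>j. expectation (\<lambda>\<omega>. (norm (S j \<omega>))\<^sup>2)) \<longlonglongrightarrow> (\<Sum>b\<in>Basis. LINT \<omega>|N. (b \<bullet> W \<omega>)\<^sup>2)"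
    unfolding norm_square_eq_sum_Basis using u_S by (simp add: tendsto_sum var)
  then have "Bseq (\<lambda>j. expectation (\<lambda>\<omega>. (norm (S j \<omega>))\<^sup>2))"
    by (intro convergent_imp_Bseq convergentI)
  then obtain V where "\<forall>j. norm (expectation (\<lambda>\<omega>. (norm (S j \<omega>))\<^sup>2)) \<le> V"
    by (auto simp only: Bseq_def)
  then have V: "expectation (\<lambda>\<omega>. (norm (S j \<omega>))\<^sup>2) \<le> V" for j
    by (simp add: abs_le_iff)
  have B_borel[measurable]: "B \<in> sets borel" using B by (simp add: continuity_set_def)
  have "(\<lambda>j. measure (distr M borel (S j)) B) \<longlonglongrightarrow> measure (distr N borel W) B"
  proof (rule portmanteau_continuity_set)
    show "prob_space (distr M borel (S j))" for j by (rule prob_space_distr) simp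
    show "prob_space (distr N borel W)" by (rule N.prob_space_distr) simp
    show "measure (distr N borel W) (frontier B) = 0"
      using B by (simp add: continuity_set_def measure_distr vimage_def Int_def conj_commute)
    fix f :: "'b \<Rightarrow> real" assume f: "continuous_on UNIV f" "\<And>x. \<bar>f x\<bar> \<le> 1"
    show "(\<lambda>j. LINT x|distr M borel (S j). f x) \<longlonglongrightarrow> (LINT x|distr N borel W. f x)"
    proof (rule char_tendsto_imp_integral_tendsto[OF _ _ _ _ _ _ _ _ f])
      show "prob_space (distr M borel (S j))" for j by (rule prob_space_distr) simp
      show "prob_space (distr N borel W)" by (rule N.prob_space_distr) simp
      show "integrable (distr M borel (S j)) (\<lambda>x. (norm x)\<^sup>2)" for j
        unfolding norm_square_eq_sum_Basis using u_S by (simp add: integrable_distr_eq)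
      show "integrable (distr N borel W) (\<lambda>x. (norm x)\<^sup>2)"
        unfolding norm_square_eq_sum_Basis using N.gaussian_vector_square_integrable[OF W]
        by (simp add: integrable_distr_eq)
      show "(LINT x|distr M borel (S j). (norm x)\<^sup>2) \<le> V" for j
        using V by (simp add: integral_distr)
      show "(\<lambda>j. LINT x|distr M borel (S j). iexp (u \<bullet> x)) \<longlonglongrightarrow> (LINT x|distr N borel W. iexp (u \<bullet> x))" for u
        using char[of u] by (simp add: integral_distr)
    qed simp_all
  qed simp_all
  then show ?thesis
    by (simp add: measure_distr vimage_def Int_def conj_commute S_def)
qed

text \<open>Uniformity in the row number and the row length is what allows a random row length to be
  substituted.\<close>

lemma (in prob_space) lyapunov_clt_uniform:
  fixes Y :: "nat \<Rightarrow> nat \<Rightarrow> 'a \<Rightarrow> complex ^ 'd" and p \<epsilon> :: real and W :: "'c \<Rightarrow> complex ^ 'd"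
  assumes indep: "\<And>n. indep_vars (\<lambda>_. borel) (Y n) {1..}"
    and sq: "\<And>n k. k \<ge> 1 \<Longrightarrow> integrable M (\<lambda>\<omega>. (norm (Y n k \<omega>))\<^sup>2)"
    and p: "p > 2"
    and N: "prob_space N" and W: "gaussian_vector N W" and W_mean: "integral\<^sup>L N W = 0"
    and B: "continuity_set N W B"
    and \<epsilon>: "\<epsilon> > 0"
  shows "\<exists>\<delta>>0. \<forall>n m.
      dist (\<Sum>k=1..m. Cov M (Y n k) (Y n k)) (Var N W) \<le> \<delta> \<longrightarrow>
      dist (\<Sum>k=1..m. Cov M (Y n k) (\<lambda>\<omega>. cnj_vec (Y n k \<omega>))) (Cov N W (\<lambda>\<omega>. cnj_vec (W \<omega>))) \<le> \<delta> \<longrightarrow>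
      (\<Sum>k=1..m. \<integral>\<^sup>+\<omega>. ennreal (norm (Y n k \<omega> - expectation (Y n k)) powr p) \<partial>M) \<le> ennreal \<delta> \<longrightarrow>
      dist (prob {\<omega> \<in> space M. (\<Sum>k=1..m. Y n k \<omega> - expectation (Y n k)) \<in> B})
        (measure N {\<omega> \<in> space N. W \<omega> \<in> B}) \<le> \<epsilon>"
proof (rule ccontr)
  interpret N: prob_space N by fact
  define D where "D n k \<omega> = Y n k \<omega> - expectation (Y n k)" for n k \<omega>
  define C1 where "C1 n m = (\<Sum>k=1..m. Cov M (Y n k) (Y n k))" for n m
  define C2 where "C2 n m = (\<Sum>k=1..m. Cov M (Y n k) (\<lambda>\<omega>. cnj_vec (Y n k \<omega>)))" for n m
  define L where "L n m = (\<Sum>k=1..m. \<integral>\<^sup>+\<omega>. ennreal (norm (D n k \<omega>) powr p) \<partial>M)" for n m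
  define q where "q n m = prob {\<omega> \<in> space M. (\<Sum>k=1..m. D n k \<omega>) \<in> B}" for n m
  define w where "w = measure N {\<omega> \<in> space N. W \<omega> \<in> B}"
  assume contr: "\<not> ?thesis"
  have "\<exists>n m. dist (C1 n m) (Var N W) \<le> \<delta> \<and> dist (C2 n m) (Cov N W (\<lambda>\<omega>. cnj_vec (W \<omega>))) \<le> \<delta> \<and>
      L n m \<le> ennreal \<delta> \<and> \<not> dist (q n m) w \<le> \<epsilon>" if \<delta>: "\<delta> > 0" for \<delta>
    using contr \<delta> unfolding C1_def C2_def L_def q_def w_def D_def by blast
  \<comment> \<open>A counterexample for each tolerance \<open>inverse (Suc j)\<close>. The row
    numbers \<open>n j\<close> need not grow: the selected truncated rows are simply re-indexed by
    \<open>j\<close> and form a new array.\<close>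
  then have "\<exists>n m. dist (C1 n m) (Var N W) \<le> inverse (Suc j) \<and>
      dist (C2 n m) (Cov N W (\<lambda>\<omega>. cnj_vec (W \<omega>))) \<le> inverse (Suc j) \<and>
      L n m \<le> ennreal (inverse (Suc j)) \<and> \<not> dist (q n m) w \<le> \<epsilon>" for j
    by simp
  then obtain n m where nm: "\<And>j. dist (C1 (n j) (m j)) (Var N W) \<le> inverse (Suc j)"
      "\<And>j. dist (C2 (n j) (m j)) (Cov N W (\<lambda>\<omega>. cnj_vec (W \<omega>))) \<le> inverse (Suc j)"
      "\<And>j. L (n j) (m j) \<le> ennreal (inverse (Suc j))"
      "\<And>j. \<not> dist (q (n j) (m j)) w \<le> \<epsilon>"
    by metis
  have rv[measurable]: "random_variable borel (Y n k)" if "k \<ge> 1" for n k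
    using indep that unfolding indep_vars_def2 by auto
  have int: "integrable M (Y n k)" if "k \<ge> 1" for n k
    by (rule integrable_of_norm_square[OF rv[OF that] sq[OF that]])
  have Dm[measurable]: "random_variable borel (D n k)" if "k \<ge> 1" for n k
    using that unfolding D_def[abs_def] by measurable
  have D_sq: "integrable M (\<lambda>\<omega>. (norm (D n k \<omega>))\<^sup>2)" if k: "k \<ge> 1" for n k
  proof -
    have "(norm (D n k \<omega>))\<^sup>2
        = (norm (Y n k \<omega>))\<^sup>2 - 2 * (expectation (Y n k) \<bullet> Y n k \<omega>) + (norm (expectation (Y n k)))\<^sup>2" for \<omega>
      by (simp add: D_def power2_norm_eq_inner algebra_simps inner_commute)
    then show ?thesis using sq[OF k] int[OF k] by simp
  qed
  have D_mean: "expectation (D n k) = 0" if "k \<ge> 1" for n k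
    using int[OF that] by (simp add: D_def[abs_def] prob_space)
  have W_rv: "W \<in> borel_measurable N"
    using W by (simp add: gaussian_vector_def)
  have W_sq: "integrable N (\<lambda>\<omega>. (u \<bullet> W \<omega>)\<^sup>2)" for u
    by (rule N.gaussian_vector_square_integrable[OF W])
  have W_int: "integrable N W"
    by (rule N.integrable_vector_of_square[OF W_rv W_sq])
  have "integrable N (\<lambda>\<omega>. (norm (W \<omega>))\<^sup>2)"
    unfolding norm_square_eq_sum_Basis using W_sq by simp
  then have W_var: "(LINT \<omega>|N. (u \<bullet> W \<omega>)\<^sup>2) = cov_quad u (Var N W) (Cov N W (\<lambda>\<omega>. cnj_vec (W \<omega>)))" for u
    using N.variance_inner_eq_cov_quad[OF W_rv _ W_int, of u] by (simp add: W_mean Var_def)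
  have D_var: "(\<Sum>k=1..m. expectation (\<lambda>\<omega>. (u \<bullet> D n k \<omega>)\<^sup>2)) = cov_quad u (C1 n m) (C2 n m)" for u n m
    unfolding C1_def C2_def cov_quad_sum D_def
    by (intro sum.cong refl variance_inner_eq_cov_quad rv int D_sq[unfolded D_def]) auto
  have lim0: "(\<lambda>j. inverse (real (Suc j))) \<longlonglongrightarrow> 0" by (rule LIMSEQ_inverse_real_of_nat)
  have C1: "(\<lambda>j. C1 (n j) (m j)) \<longlonglongrightarrow> Var N W"
    and C2: "(\<lambda>j. C2 (n j) (m j)) \<longlonglongrightarrow> Cov N W (\<lambda>\<omega>. cnj_vec (W \<omega>))"
    unfolding tendsto_dist_iff[of _ "Var N W"] tendsto_dist_iff[of _ "Cov N W _"]
    by (rule tendsto_sandwich[OF _ _ tendsto_const lim0]; use nm in auto)+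
  \<comment> \<open>Finiteness of the \<open>p\<close>-th moments is extracted from the bound on
    \<open>L\<close>, each summand being at most the sum. This works because \<open>L\<close> uses
    extended nonnegative integrals; a Bochner integral would default to \<open>0\<close> when the
    moment is infinite.\<close>
  have L_fin: "(\<integral>\<^sup>+\<omega>. ennreal (norm (D (n j) k \<omega>) powr p) \<partial>M) \<le> ennreal (inverse (Suc j))"
    if "k \<in> {1..m j}" for j k
    using nm(3)[of j]
      member_le_sum[OF that, of "\<lambda>k. \<integral>\<^sup>+\<omega>. ennreal (norm (D (n j) k \<omega>) powr p) \<partial>M"]
    unfolding L_def by (meson finite_atLeastAtMost order_trans zero_le)
  have mom: "integrable M (\<lambda>\<omega>. norm (D (n j) k \<omega>) powr p)" if k: "k \<in> {1..m j}" for j k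
  proof (rule integrableI_bounded)
    show "(\<integral>\<^sup>+\<omega>. ennreal (norm (norm (D (n j) k \<omega>) powr p)) \<partial>M) < \<infinity>"
      using order_le_less_trans[OF L_fin[OF k] ennreal_less_top] by simp
    have "random_variable borel (D (n j) k)" using k by (intro Dm) simp
    then show "random_variable borel (\<lambda>\<omega>. norm (D (n j) k \<omega>) powr p)" by measurable
  qed
  have L_real: "L (n j) (m j) = ennreal (\<Sum>k=1..m j. expectation (\<lambda>\<omega>. norm (D (n j) k \<omega>) powr p))" for j
  proof -
    have "L (n j) (m j) = (\<Sum>k=1..m j. ennreal (expectation (\<lambda>\<omega>. norm (D (n j) k \<omega>) powr p)))"
      unfolding L_def by (intro sum.cong refl nn_integral_eq_integral mom) auto
    also have "\<dots> = ennreal (\<Sum>k=1..m j. expectation (\<lambda>\<omega>. norm (D (n j) k \<omega>) powr p))"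
      by (rule sum_ennreal) simp
    finally show ?thesis .
  qed
  have "(\<lambda>j. q (n j) (m j)) \<longlonglongrightarrow> w"
    unfolding q_def w_def
  proof (rule lyapunov_clt[OF _ _ _ _ mom p N W W_mean _ _ B])
    show "indep_vars (\<lambda>_. borel) (D (n j)) {1..m j}" for j
      unfolding D_def[abs_def]
      by (rule indep_vars_compose2[OF indep_vars_subset[OF indep]]) auto
    show "(\<lambda>j. \<Sum>k=1..m j. expectation (\<lambda>\<omega>. (u \<bullet> D (n j) k \<omega>)\<^sup>2)) \<longlonglongrightarrow> (LINT \<omega>|N. (u \<bullet> W \<omega>)\<^sup>2)" for u
      unfolding D_var W_var by (rule tendsto_cov_quad[OF C1 C2])
    show "(\<lambda>j. \<Sum>k=1..m j. expectation (\<lambda>\<omega>. norm (D (n j) k \<omega>) powr p)) \<longlonglongrightarrow> 0"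
    proof (rule tendsto_sandwich[OF _ _ tendsto_const lim0]; rule always_eventually; rule allI)
      show "0 \<le> (\<Sum>k=1..m j. expectation (\<lambda>\<omega>. norm (D (n j) k \<omega>) powr p))" for j
        by (auto intro: sum_nonneg)
      show "(\<Sum>k=1..m j. expectation (\<lambda>\<omega>. norm (D (n j) k \<omega>) powr p)) \<le> inverse (real (Suc j))" for j
        using nm(3)[of j] unfolding L_real by (subst (asm) ennreal_le_iff) auto
    qed
  qed (use D_sq D_mean in auto)
  then have "\<forall>\<^sub>F j in sequentially. dist (q (n j) (m j)) w < \<epsilon>"
    using \<epsilon> by (rule tendstoD)
  then show False
    using nm(4) by (auto simp: eventually_sequentially dest: less_imp_le)
qed

section \<open>From fixed to random row lengths\<close>

lemma (in prob_space) indep_set_row_event: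
  fixes Y :: "nat \<Rightarrow> 'a \<Rightarrow> 'b :: euclidean_space"
  assumes indep: "indep_set (sets F)
        (sets (sigma_gen M (PiM {1..} (\<lambda>_. borel)) (\<lambda>\<omega>. \<lambda>k\<in>{1..}. Y k \<omega>)))"
    and C: "C \<in> sets F" and B[measurable]: "B \<in> sets borel"
  shows "prob (C \<inter> {\<omega> \<in> space M. (\<Sum>k=1..m. Y k \<omega> - c k) \<in> B})
    = prob C * prob {\<omega> \<in> space M. (\<Sum>k=1..m. Y k \<omega> - c k) \<in> B}"
proof (rule indep_setD[OF indep C])
  let ?R = "\<lambda>\<omega>. \<lambda>k\<in>{1::nat..}. Y k \<omega>"
  let ?D = "{y \<in> space (PiM {1..} (\<lambda>_. borel :: 'b measure)). (\<Sum>k=1..m. y k - c k) \<in> B}"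
  have "(\<lambda>y. \<Sum>k=1..m. y k - c k) \<in> borel_measurable (PiM {1..} (\<lambda>_. borel :: 'b measure))"
    by (intro borel_measurable_sum borel_measurable_diff measurable_component_singleton) auto
  then have D: "?D \<in> sets (PiM {1..} (\<lambda>_. borel))" by measurable
  \<comment> \<open>The event depends on finitely many coordinates, so it is the preimage under the
    whole row of a set in the product sigma-algebra.\<close>
  have "{\<omega> \<in> space M. (\<Sum>k=1..m. Y k \<omega> - c k) \<in> B} = ?R -` ?D \<inter> space M"
    by (auto simp: space_PiM)
  also have "\<dots> \<in> sets (sigma_gen M (PiM {1..} (\<lambda>_. borel)) ?R)"
    unfolding sigma_gen_def by (rule in_vimage_algebra[OF D])
  finally show "{\<omega> \<in> space M. (\<Sum>k=1..m. Y k \<omega> - c k) \<in> B}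
      \<in> sets (sigma_gen M (PiM {1..} (\<lambda>_. borel)) ?R)" .
qed

theorem lemma5p5:
  fixes M :: "'a measure"
    and K :: "nat \<Rightarrow> 'a \<Rightarrow> nat"
    and Y :: "nat \<Rightarrow> nat \<Rightarrow> 'a \<Rightarrow> complex ^ 'd"
    and \<Sigma>1 \<Sigma>2 :: "complex ^ 'd ^ 'd"
    and N :: "'b measure"
    and W :: "'b \<Rightarrow> complex ^ 'd"
    and B :: "(complex ^ 'd) set"
  assumes "prob_space M"
    and K_measurable: "\<And>n. K n \<in> measurable M (count_space UNIV)"
    and K_pos: "\<And>n \<omega>. \<omega> \<in> space M \<Longrightarrow> K n \<omega> > 0"
    and Y_indep: "\<And>n. prob_space.indep_vars M (\<lambda>_. borel) (Y n) {1..}"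
    and Y_indep_K: "\<And>n. prob_space.indep_set M
          (sets (sigma_gen M (count_space UNIV) (K n)))
          (sets (sigma_gen M (PiM {1..} (\<lambda>_. borel)) (\<lambda>\<omega>. \<lambda>k\<in>{1..}. Y n k \<omega>)))"
    and Y_square_integrable: "\<And>n k. k \<ge> 1 \<Longrightarrow> integrable M (\<lambda>\<omega>. (norm (Y n k \<omega>))\<^sup>2)"
    and K_tendsto: "\<And>m. (\<lambda>n. measure M {\<omega> \<in> space M. K n \<omega> > m}) \<longlonglongrightarrow> 1"
    and Cov1: "tendsto_in_prob M (\<lambda>n \<omega>. \<Sum>k=1..K n \<omega>. Cov M (Y n k) (Y n k)) \<Sigma>1"
    and Cov2: "tendsto_in_prob M
          (\<lambda>n \<omega>. \<Sum>k=1..K n \<omega>. Cov M (Y n k) (\<lambda>\<omega>'. cnj_vec (Y n k \<omega>'))) \<Sigma>2"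
    and Lyapunov: "\<exists>p::real. p > 2 \<and> (\<forall>\<epsilon>::real. \<epsilon> > 0 \<longrightarrow>
          (\<lambda>n. measure M {\<omega> \<in> space M.
             (\<Sum>k=1..K n \<omega>. \<integral>\<^sup>+\<omega>'. ennreal (norm (Y n k \<omega>' - integral\<^sup>L M (Y n k)) powr p) \<partial>M)
               > ennreal \<epsilon>}) \<longlonglongrightarrow> 0)"
    and "prob_space N"
    and W_gaussian: "gaussian_vector N W"
    and W_mean: "integral\<^sup>L N W = 0"
    and W_Var: "Var N W = \<Sigma>1"
    and W_Cov: "Cov N W (\<lambda>\<omega>. cnj_vec (W \<omega>)) = \<Sigma>2"
    and B: "continuity_set N W B"
  shows "tendsto_in_prob M
           (\<lambda>n. cond_prob_given M
              (\<lambda>\<omega>. (\<Sum>k=1..K n \<omega>. Y n k \<omega> - integral\<^sup>L M (Y n k)) \<in> B) (K n))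
           (measure N {\<omega> \<in> space N. W \<omega> \<in> B})"
proof -
  interpret prob_space M by fact
  obtain p :: real where p: "p > 2" and Lyap: "\<And>\<epsilon>::real. \<epsilon> > 0 \<Longrightarrow>
      (\<lambda>n. prob {\<omega> \<in> space M.
         (\<Sum>k=1..K n \<omega>. \<integral>\<^sup>+\<omega>'. ennreal (norm (Y n k \<omega>' - expectation (Y n k)) powr p) \<partial>M)
           > ennreal \<epsilon>}) \<longlonglongrightarrow> 0"
    using Lyapunov by blast
  define A where "A n m = {\<omega> \<in> space M. (\<Sum>k=1..m. Y n k \<omega> - expectation (Y n k)) \<in> B}" for n m
  define w where "w = measure N {\<omega> \<in> space N. W \<omega> \<in> B}"
  define c where "c n = cond_prob_given M
      (\<lambda>\<omega>. (\<Sum>k=1..K n \<omega>. Y n k \<omega> - expectation (Y n k)) \<in> B) (K n)" for n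
  have B_borel[measurable]: "B \<in> sets borel" using B by (simp add: continuity_set_def)
  have rv[measurable]: "random_variable borel (Y n k)" if "k \<ge> 1" for n k
    using Y_indep that unfolding indep_vars_def2 by auto
  have A_events: "A n m \<in> events" for n m
  proof -
    have "random_variable borel (\<lambda>\<omega>. \<Sum>k=1..m. Y n k \<omega> - expectation (Y n k))"
      by (intro borel_measurable_sum borel_measurable_diff rv) auto
    then show ?thesis unfolding A_def by measurable
  qed
  \<comment> \<open>Conditioning on \<open>K n\<close> amounts to inserting its value into the
    unconditional fixed-length probabilities.\<close>
  have c_eq: "AE \<omega> in M. c n \<omega> = prob (A n (K n \<omega>))" for n
    unfolding c_def
  proof (rule cond_prob_given_random_index[OF K_measurable A_events])
    show "prob (C \<inter> A n m) = prob C * prob (A n m)"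
      if "C \<in> sets (sigma_gen M (count_space UNIV) (K n))" for C m
      unfolding A_def by (rule indep_set_row_event[OF Y_indep_K that B_borel])
  qed (simp add: A_def)
  have [measurable]: "c n \<in> borel_measurable M" for n
    unfolding c_def cond_prob_given_def by simp
  \<comment> \<open>\<open>K n\<close> is discrete, so any condition on its value is an event,
    whatever the functions of the row length occurring in it.\<close>
  have K_event[measurable]: "{\<omega> \<in> space M. Q (K n \<omega>)} \<in> events" for Q n
    using measurable_sets[OF K_measurable, of "Collect Q" n] by (simp add: vimage_def Int_def conj_commute)
  have "(\<lambda>n. prob {\<omega> \<in> space M. dist (c n \<omega>) w > \<epsilon>}) \<longlonglongrightarrow> 0" if \<epsilon>: "\<epsilon> > 0" for \<epsilon>
  proof -
    have "\<exists>\<delta>>0. \<forall>n m.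
        dist (\<Sum>k=1..m. Cov M (Y n k) (Y n k)) \<Sigma>1 \<le> \<delta> \<longrightarrow>
        dist (\<Sum>k=1..m. Cov M (Y n k) (\<lambda>\<omega>. cnj_vec (Y n k \<omega>))) \<Sigma>2 \<le> \<delta> \<longrightarrow>
        (\<Sum>k=1..m. \<integral>\<^sup>+\<omega>. ennreal (norm (Y n k \<omega> - expectation (Y n k)) powr p) \<partial>M) \<le> ennreal \<delta> \<longrightarrow>
        dist (prob (A n m)) w \<le> \<epsilon>"
      unfolding A_def w_def W_Var[symmetric] W_Cov[symmetric]
      by (rule lyapunov_clt_uniform[OF Y_indep Y_square_integrable p \<open>prob_space N\<close> W_gaussian
          W_mean B \<epsilon>])
    then obtain \<delta> where \<delta>: "\<delta> > 0"
      "\<And>n m. dist (\<Sum>k=1..m. Cov M (Y n k) (Y n k)) \<Sigma>1 \<le> \<delta> \<Longrightarrow>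
        dist (\<Sum>k=1..m. Cov M (Y n k) (\<lambda>\<omega>. cnj_vec (Y n k \<omega>))) \<Sigma>2 \<le> \<delta> \<Longrightarrow>
        (\<Sum>k=1..m. \<integral>\<^sup>+\<omega>. ennreal (norm (Y n k \<omega> - expectation (Y n k)) powr p) \<partial>M) \<le> ennreal \<delta> \<Longrightarrow>
        dist (prob (A n m)) w \<le> \<epsilon>"
      by blast
    \<comment> \<open>The three ways in which the realised row length can miss the tolerance
      \<open>\<delta>\<close>. Outside their union the uniform theorem applies to the pair of
      \<open>n\<close> and \<open>K n \<omega>\<close>, and each of them has vanishing
      probability.\<close>
    define E1 where "E1 n = {\<omega> \<in> space M. dist (\<Sum>k=1..K n \<omega>. Cov M (Y n k) (Y n k)) \<Sigma>1 > \<delta>}" for n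
    define E2 where "E2 n = {\<omega> \<in> space M.
      dist (\<Sum>k=1..K n \<omega>. Cov M (Y n k) (\<lambda>\<omega>'. cnj_vec (Y n k \<omega>'))) \<Sigma>2 > \<delta>}" for n
    define E3 where "E3 n = {\<omega> \<in> space M.
      (\<Sum>k=1..K n \<omega>. \<integral>\<^sup>+\<omega>'. ennreal (norm (Y n k \<omega>' - expectation (Y n k)) powr p) \<partial>M)
        > ennreal \<delta>}" for n
    have ev: "E1 n \<in> events" "E2 n \<in> events" "E3 n \<in> events" for n
      unfolding E1_def E2_def E3_def by (rule K_event)+
    have le: "prob {\<omega> \<in> space M. dist (c n \<omega>) w > \<epsilon>} \<le> prob (E1 n) + prob (E2 n) + prob (E3 n)" for n
    proof -
      have "prob {\<omega> \<in> space M. dist (c n \<omega>) w > \<epsilon>} = prob {\<omega> \<in> space M. dist (prob (A n (K n \<omega>))) w > \<epsilon>}"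
      proof (rule measure_eq_AE)
        show "AE \<omega> in M. \<omega> \<in> {\<omega> \<in> space M. dist (c n \<omega>) w > \<epsilon>}
            \<longleftrightarrow> \<omega> \<in> {\<omega> \<in> space M. dist (prob (A n (K n \<omega>))) w > \<epsilon>}"
          using c_eq[of n] by eventually_elim simp
        show "{\<omega> \<in> space M. dist (prob (A n (K n \<omega>))) w > \<epsilon>} \<in> events" by (rule K_event)
      qed measurable
      also have "\<dots> \<le> prob (E1 n \<union> E2 n \<union> E3 n)"
      proof (rule finite_measure_mono)
        show "{\<omega> \<in> space M. dist (prob (A n (K n \<omega>))) w > \<epsilon>} \<subseteq> E1 n \<union> E2 n \<union> E3 n"
        proof
          fix \<omega> assume "\<omega> \<in> {\<omega> \<in> space M. dist (prob (A n (K n \<omega>))) w > \<epsilon>}"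
          then have \<omega>: "\<omega> \<in> space M" and "\<not> dist (prob (A n (K n \<omega>))) w \<le> \<epsilon>" by auto
          then show "\<omega> \<in> E1 n \<union> E2 n \<union> E3 n"
            using \<delta>(2) \<omega>
            unfolding E1_def E2_def E3_def Un_iff mem_Collect_eq not_le[symmetric] by blast
        qed
      qed (use ev in auto)
      also have "\<dots> \<le> prob (E1 n \<union> E2 n) + prob (E3 n)"
        by (rule measure_Un_le) (use ev in auto)
      also have "\<dots> \<le> prob (E1 n) + prob (E2 n) + prob (E3 n)"
        by (intro add_right_mono measure_Un_le ev)
      finally show ?thesis .
    qed
    have lim: "(\<lambda>n. prob (E1 n) + prob (E2 n) + prob (E3 n)) \<longlonglongrightarrow> 0 + 0 + 0"
      unfolding E1_def E2_def E3_def
      using Cov1 Cov2 Lyap \<open>\<delta> > 0\<close> by (intro tendsto_add) (auto simp: tendsto_in_prob_def)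
    show ?thesis
      by (rule tendsto_sandwich[OF _ _ tendsto_const lim[simplified]]) (simp_all add: le)
  qed
  then show ?thesis
    unfolding tendsto_in_prob_def c_def w_def by blast
qed

end
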